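(* Let $n\in\mathbb N$, $p>n$ and $\alpha\in(0,n)$. Set $\sigma=\frac{p\alpha}{p+\alpha-n}$ and let $\gamma>1+\sigma$. Let $\phi$ be a gauge function such that $\phi(r)\sim r^\sigma(\log\frac1r)^\gamma$ near zero. Then there exist a map $u\in V^{1,p}(\mathbb R^n,\mathbb R^n)$ and a compact set $E\subset\mathbb R^n$ such that $0<\mathscr H^\alpha(E)<\infty$ and $\mathscr H^\phi(u(E))=\infty$.
   Context: A gauge function is an increasing continuous function $\phi\colon[0,\infty)\to[0,\infty)$ vanishing only at $0$. For $E\subset\mathbb R^k$, $\mathscr H^\phi(E)=\lim_{\sigma\to0^+}\inf\{\sum_i\phi(d(E_i)): d(E_i)\le\sigma, E\subset\bigcup_iE_i\}$ ($d$ = diameter); $\mathscr H^\alpha$ is the case $\phi(r)=r^\alpha$. $V^{1,p}(\mathbb R^n,\mathbb R^n)$ is the space of weakly differentiable $u\in L^1_{\rm loc}$ with $|\nabla u|\in L^p(\mathbb R^n)$ (continuous representative used). "$f\sim g$ near zero" means $c^{-1}g\le f\le cg$ on some interval $(0,r_0)$ for some constant $c>0$. *)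

theory Defs
  imports "HOL-Analysis.Analysis"
begin

definition gauge_function :: "(real \<Rightarrow> real) \<Rightarrow> bool" where
  "gauge_function \<phi> \<longleftrightarrow> mono_on {0..} \<phi> \<and> continuous_on {0..} \<phi> \<and>
     (\<forall>r\<ge>0. \<phi> r \<ge> 0) \<and> (\<forall>r\<ge>0. \<phi> r = 0 \<longleftrightarrow> r = 0)"

definition hausdorff_pre :: "(real \<Rightarrow> real) \<Rightarrow> real \<Rightarrow> 'a::metric_space set \<Rightarrow> ennreal" where
  "hausdorff_pre \<phi> \<delta> E = (INF C \<in> {C :: nat \<Rightarrow> 'a set. E \<subseteq> (\<Union>i. C i) \<and>
        (\<forall>i. bounded (C i) \<and> diameter (C i) \<le> \<delta>)}. (\<Sum>i. ennreal (\<phi> (diameter (C i)))))"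

text \<open>Generalized Hausdorff measure; the limit as delta tends to 0+ is the supremum,
  since the approximating contents are nonincreasing in delta.\<close>
definition hausdorff_gauge :: "(real \<Rightarrow> real) \<Rightarrow> 'a::metric_space set \<Rightarrow> ennreal" where
  "hausdorff_gauge \<phi> E = (SUP \<delta> \<in> {0<..}. hausdorff_pre \<phi> \<delta> E)"

abbreviation hausdorff_dim :: "real \<Rightarrow> 'a::metric_space set \<Rightarrow> ennreal" where
  "hausdorff_dim a E \<equiv> hausdorff_gauge (\<lambda>r. r powr a) E"

definition pderiv_dir :: "'a::euclidean_space \<Rightarrow> ('a \<Rightarrow> real) \<Rightarrow> 'a \<Rightarrow> real" where
  "pderiv_dir i f x = frechet_derivative f (at x) i"

definition smooth_fun :: "('a::euclidean_space \<Rightarrow> real) \<Rightarrow> bool" where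
  "smooth_fun f \<longleftrightarrow> (\<forall>ds. set ds \<subseteq> Basis \<longrightarrow>
      (\<forall>x. (foldr pderiv_dir ds f) differentiable (at x)))"

definition test_fun :: "('a::euclidean_space \<Rightarrow> real) \<Rightarrow> bool" where
  "test_fun \<psi> \<longleftrightarrow> smooth_fun \<psi> \<and> compact (closure {x. \<psi> x \<noteq> 0})"

definition locally_integrable :: "('a::euclidean_space \<Rightarrow> 'b::euclidean_space) \<Rightarrow> bool" where
  "locally_integrable f \<longleftrightarrow> f \<in> borel_measurable lborel \<and>
      (\<forall>K. compact K \<longrightarrow> set_integrable lborel K f)"

definition weak_gradient :: "('a::euclidean_space \<Rightarrow> 'b::euclidean_space) \<Rightarrow> ('a \<Rightarrow> 'a \<Rightarrow> 'b) \<Rightarrow> bool" where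
  "weak_gradient u G \<longleftrightarrow> (\<forall>i\<in>Basis. locally_integrable (\<lambda>x. G x i) \<and>
      (\<forall>\<psi>. test_fun \<psi> \<longrightarrow>
        (LINT x|lborel. pderiv_dir i \<psi> x *\<^sub>R u x) = - (LINT x|lborel. \<psi> x *\<^sub>R G x i)))"

definition V1p :: "real \<Rightarrow> ('a::euclidean_space \<Rightarrow> 'b::euclidean_space) set" where
  "V1p p = {u. locally_integrable u \<and> (\<exists>G. weak_gradient u G \<and>
      integrable lborel (\<lambda>x. (sqrt (\<Sum>i\<in>Basis. (norm (G x i))\<^sup>2)) powr p))}"

end

theory Submission
  imports Defs "HOL-Probability.Infinite_Product_Measure"
begin

text \<open>Write $n$ for the dimension, $\lambda = 2^{-n/\alpha}$ and $\tau = 2^{-n/\sigma}$; both are below $1/2$.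
  Let $E$ be the Cantor set of all sums $\sum_k \frac12\lambda^k \omega_k$ with digits
  $\omega_k \in \{-1,1\}^n$, and let $f_k$ be a $C^1$ map that reads off the digit $\omega_k$ on $E$:
  $f_0$ is constant on each of the $2^n$ first-generation cubes, and $f_{k+1}$ is the sum of the
  copies of $f_k$ rescaled to these cubes. Put $u = \sum_k R_k f_k$ with $R_k = \tau^k/(k+1)$.
  The gradients $\nabla f_k$ have pairwise disjoint supports and
  $\int |\nabla f_k|^p = (2^n\lambda^{n-p})^k \int|\nabla f_0|^p$, where
  $\tau^p\, 2^n\lambda^{n-p} = 1$, so $\int|\nabla u|^p$ is a multiple of $\sum_k (k+1)^{-p} < \infty$.
  The image $u(E)$ is the set of all sums $\sum_k R_k \omega_k$; its natural measure gives mass $2^{-nk}$ to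
  pieces of diameter comparable to $R_k$, and $2^{nk}\phi(R_k)$ is of order $k^{\gamma-\sigma}$, which is unbounded.\<close>

subsection \<open>A mass distribution principle for symbolic codings\<close>

text \<open>\<lambda> and \<tau> solve 2^n \<lambda>^\<alpha> = 1 and 2^n \<tau>^\<sigma> = 1: the
  mass 2^{-nk} of a piece of generation k is the \<alpha>-th power of its scale in E, and with
  weights \<tau>^k it would be the \<sigma>-th power of its scale in the image. With those weights,
  however, every generation carries the same energy and the total diverges; \<sigma> is the critical
  exponent. Damping by 1/(k+1) makes the energies summable because p > 1, and costs only a factor
  k^{-\<sigma>} in R_k^\<sigma>, which the logarithmic factor, of order k^\<gamma>, more than
  repays.

  The cut-offs are placed in the gaps between the cubes, which exist because \<lambda> < 1/2; this
  separates the gradients of different generations and removes all cross terms from the energy.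

  Lower bounds for Hausdorff measures are proved on the space of digit sequences, where a separation
  estimate at the first differing digit is all that is asked of the coding map. The same argument
  then serves E and u(E). For the image it rests on \<tau> < 1/2, that is \<sigma> < n, which for p
  > n is equivalent to \<alpha> < n.\<close>

lemma hausdorff_pre_le_gauge: "0 < \<delta> \<Longrightarrow> hausdorff_pre \<phi> \<delta> E \<le> hausdorff_gauge \<phi> E"
  unfolding hausdorff_gauge_def by (auto intro: SUP_upper)

text \<open>The natural measure on codes makes the digits independent and uniform. Cylinders are the
  only events of positive mass that the sequel needs, since every small set meeting the coded set is
  trapped in one.\<close>

lemma emeasure_cylinder:
  fixes S :: "'b set" and \<omega> :: "nat \<Rightarrow> 'b"
  assumes S: "finite S" "S \<noteq> {}" and \<omega>: "\<And>j. \<omega> j \<in> S"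
  defines "P \<equiv> PiM UNIV (\<lambda>_::nat. uniform_count_measure S)"
  shows "{\<omega>' \<in> space P. \<forall>j<k. \<omega>' j = \<omega> j} \<in> sets P"
    and "emeasure P {\<omega>' \<in> space P. \<forall>j<k. \<omega>' j = \<omega> j} = ennreal (1 / real (card S) ^ k)"
proof -
  interpret product_prob_space "\<lambda>_::nat. uniform_count_measure S" UNIV
    by (simp add: product_prob_space_def product_prob_space_axioms_def product_sigma_finite_def
        prob_space_uniform_count_measure[OF S] prob_space_imp_sigma_finite)
  have sing: "{\<omega> j} \<in> sets (uniform_count_measure S)" for j
    using \<omega> by (simp add: sets_uniform_count_measure)
  have eq: "{\<omega>' \<in> space P. \<forall>j<k. \<omega>' j = \<omega> j} = {\<omega>' \<in> space P. \<forall>j\<in>{..<k}. \<omega>' j \<in> {\<omega> j}}"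
    by auto
  show "{\<omega>' \<in> space P. \<forall>j<k. \<omega>' j = \<omega> j} \<in> sets P"
    unfolding eq unfolding P_def using sing by measurable
  have c: "card S > 0" using S by (simp add: card_gt_0_iff)
  have "emeasure P {\<omega>' \<in> space P. \<forall>j<k. \<omega>' j = \<omega> j} = (\<Prod>j\<in>{..<k}. emeasure (uniform_count_measure S) {\<omega> j})"
    unfolding eq unfolding P_def using sing by (intro emeasure_PiM_Collect) auto
  also have "\<dots> = (\<Prod>j\<in>{..<k}. ennreal (1 / real (card S)))"
    using S \<omega> by (intro prod.cong refl) (subst emeasure_uniform_count_measure; auto)
  also have "\<dots> = ennreal (1 / real (card S) ^ k)"
    by (simp add: ennreal_power power_one_over)
  finally show "emeasure P {\<omega>' \<in> space P. \<forall>j<k. \<omega>' j = \<omega> j} = ennreal (1 / real (card S) ^ k)" .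
qed

text \<open>If \<open>C\<close> has diameter below \<open>s j\<close> for all j < k, then all codes
  of points in \<open>C\<close> share their first k digits, so they carry mass at most N^{-k}.
  Choosing k as the first index with \<open>s k\<close> at most the diameter turns this into a bound
  by \<open>M * \<phi> (diameter C)\<close>, and summing over a cover gives total mass 1 on the
  left.\<close>

lemma mass_distribution:
  fixes \<pi> :: "(nat \<Rightarrow> 'b) \<Rightarrow> 'c::metric_space" and s :: "nat \<Rightarrow> real"
  assumes S: "finite S" "card S \<ge> 2"
    and sep: "\<And>\<omega> \<omega>' k. \<lbrakk>\<And>j. \<omega> j \<in> S; \<And>j. \<omega>' j \<in> S; \<And>j. j < k \<Longrightarrow> \<omega> j = \<omega>' j; \<omega> k \<noteq> \<omega>' k\<rbrakk>
        \<Longrightarrow> s k \<le> dist (\<pi> \<omega>) (\<pi> \<omega>')"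
    and s: "\<And>k. s k > 0" "s \<longlonglongrightarrow> 0"
    and \<phi>: "mono_on {0..} \<phi>"
    and M: "M > 0" "\<And>k. k \<ge> k0 \<Longrightarrow> 1 / real (card S) ^ k \<le> M * \<phi> (s k)"
  shows "ennreal (1 / M) \<le> hausdorff_gauge \<phi> (\<pi> ` {\<omega>. \<forall>j. \<omega> j \<in> S})"
proof -
  define N where "N = real (card S)"
  have N: "N \<ge> 2" using S by (simp add: N_def)
  have S0: "S \<noteq> {}" using S by auto
  define P where "P = PiM UNIV (\<lambda>_::nat. uniform_count_measure S)"
  have spP: "space P = {\<omega>. \<forall>j. \<omega> j \<in> S}"
    by (auto simp: P_def space_PiM space_uniform_count_measure)
  interpret P: prob_space P
    unfolding P_def by (intro prob_space_PiM prob_space_uniform_count_measure S S0)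
  \<comment> \<open>Forces the index chosen for a covering set to be at least \<open>k0\<close>. The
    extra element 1 keeps the set nonempty when k0 = 0, and halving makes the comparison with each
    \<open>s j\<close> strict.\<close>
  define \<delta> where "\<delta> = Min (insert 1 (s ` {..<k0})) / 2"
  have \<delta>0: "\<delta> > 0" and \<delta>s: "\<And>j. j < k0 \<Longrightarrow> \<delta> < s j"
  proof -
    have m: "0 < Min (insert 1 (s ` {..<k0}))" using s(1) by (subst Min_gr_iff) auto
    then show "\<delta> > 0" by (simp add: \<delta>_def)
    fix j assume "j < k0"
    then have "Min (insert 1 (s ` {..<k0})) \<le> s j" by (intro Min_le) auto
    then show "\<delta> < s j" using m unfolding \<delta>_def by linarith
  qed
  \<comment> \<open>The preimage of \<open>C\<close> under \<open>\<pi>\<close> may fail to be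
    measurable, so a measurable superset is produced instead.\<close>
  have local: "\<exists>A\<in>sets P. {\<omega>\<in>space P. \<pi> \<omega> \<in> C} \<subseteq> A \<and> emeasure P A \<le> ennreal (M * \<phi> (diameter C))"
    if C: "bounded C" "diameter C \<le> \<delta>" for C
  proof (cases "\<exists>\<omega>0\<in>space P. \<pi> \<omega>0 \<in> C")
    case False
    then show ?thesis by (intro bexI[of _ "{}"]) auto
  next
    case True
    then obtain w where w: "w \<in> space P" "\<pi> w \<in> C" by blast
    then have wS: "w j \<in> S" for j by (auto simp: spP)
    define cyl where "cyl k = {\<omega>'\<in>space P. \<forall>j<k. \<omega>' j = w j}" for k
    have cyl_sets: "cyl k \<in> sets P" and cyl_em: "emeasure P (cyl k) = ennreal (1 / N ^ k)" for k
      unfolding cyl_def P_def N_def by (rule emeasure_cylinder[OF S(1) S0 wS])+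
    have sub: "{\<omega>\<in>space P. \<pi> \<omega> \<in> C} \<subseteq> cyl k" if k: "\<And>j. j < k \<Longrightarrow> diameter C < s j" for k
    proof (safe)
      fix \<omega> assume \<omega>: "\<omega> \<in> space P" "\<pi> \<omega> \<in> C"
      \<comment> \<open>\<open>sep\<close> applies only at the first differing digit, hence strong
        induction.\<close>
      have "\<omega> j = w j" if "j < k" for j
        using that
      proof (induction j rule: less_induct)
        case (less j)
        show ?case
        proof (rule ccontr)
          assume "\<omega> j \<noteq> w j"
          then have "s j \<le> dist (\<pi> \<omega>) (\<pi> w)"
            using less wS \<omega>(1) by (intro sep) (auto simp: spP)
          also have "\<dots> \<le> diameter C" using C \<omega> w by (intro diameter_bounded_bound) auto
          finally show False using k[OF less.prems] by simp
        qed
      qed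
      then show "\<omega> \<in> cyl k" using \<omega> by (simp add: cyl_def)
    qed
    show ?thesis
    proof (cases "diameter C > 0")
      case False
      define A where "A = (\<Inter>k. cyl k)"
      have [measurable]: "A \<in> sets P" using cyl_sets unfolding A_def by auto
      have "emeasure P A \<le> ennreal (1 / N ^ k)" for k
        unfolding cyl_em[symmetric] using cyl_sets by (intro emeasure_mono) (auto simp: A_def)
      moreover have "(\<lambda>k. ennreal (1 / N ^ k)) \<longlonglongrightarrow> ennreal 0"
        using N by (intro tendsto_ennrealI) (simp add: LIMSEQ_inverse_realpow_zero divide_inverse)
      ultimately have "emeasure P A \<le> ennreal 0"
        by (intro LIMSEQ_le_const) auto
      moreover have "{\<omega>\<in>space P. \<pi> \<omega> \<in> C} \<subseteq> A"
      proof -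
        have "diameter C < s j" for j using False s(1)[of j] by linarith
        then show ?thesis unfolding A_def using sub by blast
      qed
      ultimately show ?thesis by (intro bexI[of _ A]) auto
    next
      case True
      then have "\<exists>k. s k \<le> diameter C"
        using order_tendstoD(2)[OF s(2) True] by (auto simp: eventually_sequentially intro: less_imp_le)
      \<comment> \<open>Minimality gives the trapping in a cylinder of length k, and membership
        gives the comparison through monotonicity of \<open>\<phi>\<close>.\<close>
      define k where "k = (LEAST k. s k \<le> diameter C)"
      have k: "s k \<le> diameter C" unfolding k_def by (rule LeastI_ex) fact
      have k': "diameter C < s j" if "j < k" for j
        using not_less_Least[of j "\<lambda>k. s k \<le> diameter C"] that by (auto simp: k_def)
      have "k \<ge> k0" using \<delta>s[of k] k C(2) by (cases "k0 \<le> k") auto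
      then have "1 / N ^ k \<le> M * \<phi> (s k)" using M by (simp add: N_def)
      also have "\<dots> \<le> M * \<phi> (diameter C)"
        using M(1) k s(1)[of k] by (intro mult_left_mono mono_onD[OF \<phi>]) auto
      finally show ?thesis using sub[OF k'] cyl_sets cyl_em by (intro bexI[of _ "cyl k"]) (auto intro: ennreal_leI)
    qed
  qed
  have "ennreal (1 / M) \<le> hausdorff_pre \<phi> \<delta> (\<pi> ` {\<omega>. \<forall>j. \<omega> j \<in> S})"
    unfolding hausdorff_pre_def
  proof (rule INF_greatest)
    fix C :: "nat \<Rightarrow> 'c set"
    assume "C \<in> {C. \<pi> ` {\<omega>. \<forall>j. \<omega> j \<in> S} \<subseteq> (\<Union>i. C i) \<and> (\<forall>i. bounded (C i) \<and> diameter (C i) \<le> \<delta>)}"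
    then have cov: "\<pi> ` {\<omega>. \<forall>j. \<omega> j \<in> S} \<subseteq> (\<Union>i. C i)" and C: "bounded (C i)" "diameter (C i) \<le> \<delta>" for i
      by auto
    have "\<forall>i. \<exists>A. A \<in> sets P \<and> {\<omega>\<in>space P. \<pi> \<omega> \<in> C i} \<subseteq> A \<and> emeasure P A \<le> ennreal (M * \<phi> (diameter (C i)))"
      using local[OF C] by blast
    from choice[OF this]
    obtain A where A: "\<And>i. A i \<in> sets P" "\<And>i. {\<omega>\<in>space P. \<pi> \<omega> \<in> C i} \<subseteq> A i"
      "\<And>i. emeasure P (A i) \<le> ennreal (M * \<phi> (diameter (C i)))"
      by blast
    have "1 = emeasure P (space P)" by (simp add: P.emeasure_space_1)
    also have "\<dots> \<le> emeasure P (\<Union>i. A i)"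
    proof (rule emeasure_mono)
      show "space P \<subseteq> (\<Union>i. A i)"
      proof
        fix \<omega> assume \<omega>: "\<omega> \<in> space P"
        then obtain i where "\<pi> \<omega> \<in> C i" using cov unfolding spP by blast
        then show "\<omega> \<in> (\<Union>i. A i)" using A(2)[of i] \<omega> by blast
      qed
    qed (use A(1) in auto)
    also have "\<dots> \<le> (\<Sum>i. emeasure P (A i))"
      using A by (intro emeasure_subadditive_countably) auto
    also have "\<dots> \<le> (\<Sum>i. ennreal (M * \<phi> (diameter (C i))))"
      using A by (intro suminf_le) auto
    also have "\<dots> = ennreal M * (\<Sum>i. ennreal (\<phi> (diameter (C i))))"
      using M(1) by (simp add: ennreal_mult')
    finally have "ennreal (1 / M) * 1 \<le> ennreal (1 / M) * (ennreal M * (\<Sum>i. ennreal (\<phi> (diameter (C i)))))"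
      by (intro mult_left_mono) auto
    also have "\<dots> = (\<Sum>i. ennreal (\<phi> (diameter (C i))))"
      using M(1) by (simp add: mult.assoc[symmetric] ennreal_mult[symmetric])
    finally show "ennreal (1 / M) \<le> (\<Sum>i. ennreal (\<phi> (diameter (C i))))" by simp
  qed
  also have "\<dots> \<le> hausdorff_gauge \<phi> (\<pi> ` {\<omega>. \<forall>j. \<omega> j \<in> S})"
    by (rule hausdorff_pre_le_gauge) fact
  finally show ?thesis .
qed

subsection \<open>Sets of digit sums\<close>

text \<open>The digit alphabet: the vertices of the cube [-1,1]^n, one for each of the 2^n children
  of a cube.\<close>

definition signs :: "'a::euclidean_space set" where
  "signs = {s. \<forall>i\<in>Basis. s \<bullet> i = 1 \<or> s \<bullet> i = -1}"

lemma finite_signs: "finite (signs :: 'a::euclidean_space set)"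
  and card_signs: "card (signs :: 'a::euclidean_space set) = 2 ^ DIM('a)"
proof -
  let ?F = "\<lambda>f. \<Sum>i\<in>Basis. f i *\<^sub>R i :: 'a"
  have bij: "bij_betw ?F (Basis \<rightarrow>\<^sub>E {1, -1}) signs"
  proof (rule bij_betwI[where g = "\<lambda>s. \<lambda>i\<in>Basis. s \<bullet> i"])
    show "?F \<in> (Basis \<rightarrow>\<^sub>E {1, -1}) \<rightarrow> signs"
      by (fastforce simp: signs_def PiE_def Pi_def)
    show "(\<lambda>s. \<lambda>i\<in>Basis. s \<bullet> i) \<in> signs \<rightarrow> (Basis \<rightarrow>\<^sub>E {1, -1})"
      by (auto simp: signs_def)
    show "(\<lambda>i\<in>Basis. ?F f \<bullet> i) = f" if "f \<in> Basis \<rightarrow>\<^sub>E {1, -1}" for f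
      using that by (auto simp: fun_eq_iff PiE_def extensional_def)
    show "?F (\<lambda>i\<in>Basis. s \<bullet> i) = s" for s :: 'a
      by (simp add: euclidean_representation)
  qed
  have fin: "finite ((Basis :: 'a set) \<rightarrow>\<^sub>E {1, -1 :: real})" by (intro finite_PiE) auto
  show "finite (signs :: 'a set)" using bij_betw_finite[OF bij] fin by simp
  have "card (signs :: 'a set) = card ((Basis :: 'a set) \<rightarrow>\<^sub>E {1, -1 :: real})"
    using bij_betw_same_card[OF bij] by simp
  also have "\<dots> = 2 ^ DIM('a)" by (subst card_PiE) (auto simp: numeral_2_eq_2)
  finally show "card (signs :: 'a set) = 2 ^ DIM('a)" .
qed

lemma abs_signs: "s \<in> signs \<Longrightarrow> i \<in> Basis \<Longrightarrow> \<bar>s \<bullet> i\<bar> = 1"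
  by (auto simp: signs_def)

lemma norm_signs_le: "s \<in> signs \<Longrightarrow> norm s \<le> real DIM('a)" for s :: "'a::euclidean_space"
  using norm_le_l1[of s] by (simp add: abs_signs)

text \<open>A single coding for both sets: the weights \<open>l ^ k / 2\<close> produce the Cantor
  set, and the damped weights \<open>R\<close> produce its image.\<close>

definition digit_sum :: "(nat \<Rightarrow> real) \<Rightarrow> (nat \<Rightarrow> 'a::euclidean_space) \<Rightarrow> 'a" where
  "digit_sum \<rho> \<omega> = (\<Sum>k. \<rho> k *\<^sub>R \<omega> k)"

text \<open>Below ratio 1/2 the weights after index k add up to at most \<theta>/(1-\<theta>) times
  \<open>\<rho> k\<close>, which is less than \<open>\<rho> k\<close>: later digits cannot undo a
  difference in digit k.\<close>

locale digit_weights =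
  fixes \<rho> :: "nat \<Rightarrow> real" and \<theta> :: real
  assumes \<theta>: "0 < \<theta>" "\<theta> < 1/2"
    and pos: "\<And>k. 0 < \<rho> k"
    and decay: "\<And>k. \<rho> (Suc k) \<le> \<theta> * \<rho> k"
begin

lemma decay_add: "\<rho> (m + k) \<le> \<theta> ^ m * \<rho> k"
proof (induction m)
  case (Suc m)
  have "\<rho> (Suc m + k) \<le> \<theta> * \<rho> (m + k)" using decay by simp
  also have "\<dots> \<le> \<theta> * (\<theta> ^ m * \<rho> k)" using Suc \<theta> by (intro mult_left_mono) auto
  finally show ?case by (simp add: mult.assoc)
qed simp

lemma summable_weights: "summable (\<lambda>m. \<rho> (m + k))"
  by (rule summable_comparison_test'[where g = "\<lambda>m. \<theta> ^ m * \<rho> k" and N = 0])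
    (use \<theta> pos decay_add in \<open>auto intro!: summable_mult2 summable_geometric simp: less_imp_le\<close>)

lemma tail_le: "(\<Sum>m. \<rho> (m + k)) \<le> \<rho> k / (1 - \<theta>)"
proof -
  have "(\<Sum>m. \<rho> (m + k)) \<le> (\<Sum>m. \<theta> ^ m * \<rho> k)"
    using \<theta> by (intro suminf_le decay_add summable_weights summable_mult2 summable_geometric) auto
  also have "\<dots> = \<rho> k / (1 - \<theta>)"
    using \<theta> by (subst suminf_mult2[symmetric]) (auto simp: suminf_geometric summable_geometric)
  finally show ?thesis .
qed

lemma weights_tendsto_0: "\<rho> \<longlonglongrightarrow> 0"
  using summable_LIMSEQ_zero[OF summable_weights[of 0]] by simp

lemma norm_term_le: "s \<in> signs \<Longrightarrow> norm (\<rho> k *\<^sub>R s) \<le> real DIM('a) * \<rho> k" for s :: "'a::euclidean_space"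
  using mult_left_mono[OF norm_signs_le[of s], of "\<rho> k"] pos[of k] by (simp add: mult.commute)

lemma summable_digits:
  fixes \<omega> :: "nat \<Rightarrow> 'a::euclidean_space"
  assumes "\<And>j. \<omega> j \<in> signs"
  shows "summable (\<lambda>k. \<rho> k *\<^sub>R \<omega> k)"
  by (rule summable_comparison_test'[where g = "\<lambda>k. real DIM('a) * \<rho> k" and N = 0])
    (use norm_term_le assms summable_weights[of 0] in \<open>auto intro!: summable_mult\<close>)

lemma digit_sum_diff:
  fixes \<omega> \<omega>' :: "nat \<Rightarrow> 'a::euclidean_space"
  assumes \<omega>: "\<And>j. \<omega> j \<in> signs" "\<And>j. \<omega>' j \<in> signs" and eq: "\<And>j. j < k \<Longrightarrow> \<omega> j = \<omega>' j"
  shows "summable (\<lambda>m. \<rho> (m + k) *\<^sub>R (\<omega> (m + k) - \<omega>' (m + k)))"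
    and "digit_sum \<rho> \<omega> - digit_sum \<rho> \<omega>' = (\<Sum>m. \<rho> (m + k) *\<^sub>R (\<omega> (m + k) - \<omega>' (m + k)))"
proof -
  note sm = summable_diff[OF summable_digits summable_digits, of \<omega> \<omega>', OF \<omega>]
  have sm': "summable (\<lambda>j. \<rho> j *\<^sub>R (\<omega> j - \<omega>' j))" using sm by (simp add: scaleR_diff_right)
  then show "summable (\<lambda>m. \<rho> (m + k) *\<^sub>R (\<omega> (m + k) - \<omega>' (m + k)))"
    using summable_iff_shift[of "\<lambda>j. \<rho> j *\<^sub>R (\<omega> j - \<omega>' j)" k] by simp
  have "digit_sum \<rho> \<omega> - digit_sum \<rho> \<omega>' = (\<Sum>j. \<rho> j *\<^sub>R (\<omega> j - \<omega>' j))"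
    unfolding digit_sum_def scaleR_diff_right using \<omega> by (intro suminf_diff summable_digits) auto
  also have "\<dots> = (\<Sum>m. \<rho> (m + k) *\<^sub>R (\<omega> (m + k) - \<omega>' (m + k)))"
    using suminf_split_initial_segment[OF sm', of k] eq by simp
  finally show "digit_sum \<rho> \<omega> - digit_sum \<rho> \<omega>' = \<dots>" .
qed

lemma digit_sum_close:
  fixes \<omega> \<omega>' :: "nat \<Rightarrow> 'a::euclidean_space"
  assumes \<omega>: "\<And>j. \<omega> j \<in> signs" "\<And>j. \<omega>' j \<in> signs" and eq: "\<And>j. j < k \<Longrightarrow> \<omega> j = \<omega>' j"
  shows "norm (digit_sum \<rho> \<omega> - digit_sum \<rho> \<omega>') \<le> 2 * real DIM('a) * \<rho> k / (1 - \<theta>)"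
proof -
  have le: "norm (\<rho> (m + k) *\<^sub>R (\<omega> (m + k) - \<omega>' (m + k))) \<le> 2 * real DIM('a) * \<rho> (m + k)" for m
  proof -
    have "norm (\<omega> (m + k) - \<omega>' (m + k)) \<le> 2 * real DIM('a)"
      using norm_triangle_ineq4[of "\<omega> (m + k)" "\<omega>' (m + k)"] norm_signs_le[OF \<omega>(1), of "m + k"]
        norm_signs_le[OF \<omega>(2), of "m + k"] by linarith
    then show ?thesis using pos[of "m + k"] by (simp add: mult.commute mult_left_mono)
  qed
  have "norm (digit_sum \<rho> \<omega> - digit_sum \<rho> \<omega>') \<le> (\<Sum>m. 2 * real DIM('a) * \<rho> (m + k))"
    using le digit_sum_diff(2)[of \<omega> \<omega>' k] \<omega> eq
    by (auto intro!: norm_suminf_le summable_mult summable_weights)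
  also have "\<dots> = 2 * real DIM('a) * (\<Sum>m. \<rho> (m + k))"
    by (intro suminf_mult summable_weights)
  also have "\<dots> \<le> 2 * real DIM('a) * (\<rho> k / (1 - \<theta>))"
    by (intro mult_left_mono tail_le) auto
  finally show ?thesis by simp
qed

text \<open>In a coordinate where digit k differs, the leading term is exactly 2
  \<open>\<rho> k\<close> in absolute value because entries are 1 or -1, while the tail is at most
  2\<theta>/(1-\<theta>) times \<open>\<rho> k\<close>. The stated constant is the
  difference.\<close>

lemma digit_sum_separated:
  fixes \<omega> \<omega>' :: "nat \<Rightarrow> 'a::euclidean_space"
  assumes \<omega>: "\<And>j. \<omega> j \<in> signs" "\<And>j. \<omega>' j \<in> signs" and eq: "\<And>j. j < k \<Longrightarrow> \<omega> j = \<omega>' j"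
    and neq: "\<omega> k \<noteq> \<omega>' k"
  shows "2 * (1 - 2 * \<theta>) / (1 - \<theta>) * \<rho> k \<le> dist (digit_sum \<rho> \<omega>) (digit_sum \<rho> \<omega>')"
proof -
  obtain i where i: "i \<in> Basis" "\<omega> k \<bullet> i \<noteq> \<omega>' k \<bullet> i" using neq by (auto simp: euclidean_eq_iff[of "\<omega> k"])
  define a where "a m = \<rho> (m + k) * ((\<omega> (m + k) - \<omega>' (m + k)) \<bullet> i)" for m
  have d: "\<bar>(\<omega> m - \<omega>' m) \<bullet> i\<bar> \<le> 2" for m
    using abs_signs[OF \<omega>(1)[of m] i(1)] abs_signs[OF \<omega>(2)[of m] i(1)] by (simp add: inner_diff_left)
  have sma: "summable a" and suma: "(digit_sum \<rho> \<omega> - digit_sum \<rho> \<omega>') \<bullet> i = suminf a"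
    using bounded_linear.summable[OF bounded_linear_inner_left[of i] digit_sum_diff(1)[of \<omega> \<omega>' k]]
      bounded_linear.suminf[OF bounded_linear_inner_left[of i] digit_sum_diff(1)[of \<omega> \<omega>' k]]
      digit_sum_diff(2)[of \<omega> \<omega>' k] \<omega> eq by (auto simp: a_def[abs_def])
  have a0: "\<bar>a 0\<bar> = 2 * \<rho> k"
  proof -
    have "\<bar>(\<omega> k - \<omega>' k) \<bullet> i\<bar> = 2"
      using \<omega>(1)[of k] \<omega>(2)[of k] i by (fastforce simp: signs_def inner_diff_left)
    then show ?thesis using pos[of k] by (simp add: a_def abs_mult)
  qed
  have "\<bar>\<Sum>m. a (Suc m)\<bar> \<le> (\<Sum>m. 2 * \<rho> (m + Suc k))"
    unfolding real_norm_def[symmetric]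
  proof (intro norm_suminf_le summable_mult summable_weights)
    show "norm (a (Suc m)) \<le> 2 * \<rho> (m + Suc k)" for m
      using mult_left_mono[OF d[of "Suc m + k"], of "\<rho> (Suc m + k)"] pos[of "Suc m + k"]
      by (simp add: a_def abs_mult mult.commute)
  qed
  also have "\<dots> = 2 * (\<Sum>m. \<rho> (m + Suc k))"
    by (intro suminf_mult summable_weights)
  also have "\<dots> \<le> 2 * (\<rho> (Suc k) / (1 - \<theta>))"
    by (intro mult_left_mono tail_le) auto
  also have "\<dots> \<le> 2 * (\<theta> * \<rho> k / (1 - \<theta>))"
    using \<theta> by (intro mult_left_mono divide_right_mono decay) auto
  finally have tail: "\<bar>\<Sum>m. a (Suc m)\<bar> \<le> 2 * (\<theta> * \<rho> k / (1 - \<theta>))" .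
  have "2 * (1 - 2 * \<theta>) / (1 - \<theta>) * \<rho> k = 2 * \<rho> k - 2 * (\<theta> * \<rho> k / (1 - \<theta>))"
    using \<theta> by (simp add: field_simps)
  also have "\<dots> \<le> \<bar>a 0 + (\<Sum>m. a (Suc m))\<bar>" using a0 tail by linarith
  also have "a 0 + (\<Sum>m. a (Suc m)) = (digit_sum \<rho> \<omega> - digit_sum \<rho> \<omega>') \<bullet> i"
    unfolding suma using suminf_split_head[OF sma] by simp
  also have "\<bar>\<dots>\<bar> \<le> norm (digit_sum \<rho> \<omega> - digit_sum \<rho> \<omega>')" using i by (intro Basis_le_norm)
  finally show ?thesis by (simp add: dist_norm)
qed

section \<open>Hausdorff measure and compactness of digit-sum sets\<close>

text \<open>Applied twice: to the power \<alpha> for positivity of the measure of E, and to the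
  given gauge for the image. The left side of \<open>bd\<close> is the mass of a cylinder of length
  k.\<close>

lemma hausdorff_digit_set_ge:
  fixes \<phi> :: "real \<Rightarrow> real"
  assumes \<phi>: "mono_on {0..} \<phi>" and M: "M > 0"
    and bd: "\<And>k. k \<ge> k0 \<Longrightarrow> 1 / 2 ^ (DIM('a) * k) \<le> M * \<phi> (2 * (1 - 2 * \<theta>) / (1 - \<theta>) * \<rho> k)"
  shows "ennreal (1 / M) \<le> hausdorff_gauge \<phi> (digit_sum \<rho> ` {\<omega>. \<forall>j. \<omega> j \<in> (signs :: 'a::euclidean_space set)})"
proof (rule mass_distribution[where s = "\<lambda>k. 2 * (1 - 2 * \<theta>) / (1 - \<theta>) * \<rho> k" and ?k0.0 = k0])
  show "2 \<le> card (signs :: 'a set)"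
    using power_increasing[of 1 "DIM('a)" "2 :: nat"] by (simp add: card_signs DIM_positive Suc_leI)
  show "(\<lambda>k. 2 * (1 - 2 * \<theta>) / (1 - \<theta>) * \<rho> k) \<longlonglongrightarrow> 0"
    by (rule tendsto_mult_right_zero[OF weights_tendsto_0])
  show "0 < 2 * (1 - 2 * \<theta>) / (1 - \<theta>) * \<rho> k" for k
    using \<theta> pos by simp
  show "1 / real (card (signs :: 'a set)) ^ k \<le> M * \<phi> (2 * (1 - 2 * \<theta>) / (1 - \<theta>) * \<rho> k)" if "k \<ge> k0" for k
    using bd[OF that] by (simp add: card_signs power_mult)
  show "2 * (1 - 2 * \<theta>) / (1 - \<theta>) * \<rho> k \<le> dist (digit_sum \<rho> \<omega>) (digit_sum \<rho> \<omega>')"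
    if "\<And>j. \<omega> j \<in> signs" "\<And>j. \<omega>' j \<in> signs" "\<And>j. j < k \<Longrightarrow> \<omega> j = \<omega>' j" "\<omega> k \<noteq> \<omega>' k"
    for \<omega> \<omega>' :: "nat \<Rightarrow> 'a" and k
    using that by (rule digit_sum_separated)
qed (use M \<phi> finite_signs in auto)

text \<open>The code space is a product of finite sets, compact by Tychonoff, and the coding map is
  a uniform limit of partial sums depending on finitely many coordinates each.\<close>

lemma compact_digit_set: "compact (digit_sum \<rho> ` {\<omega>. \<forall>j. \<omega> j \<in> (signs :: 'a::euclidean_space set)})"
proof (rule compact_continuous_image)
  let ?\<Omega> = "{\<omega> :: nat \<Rightarrow> 'a. \<forall>j. \<omega> j \<in> signs}"
  have eq: "?\<Omega> = PiE UNIV (\<lambda>_. signs)" by auto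
  have "compactin (product_topology (\<lambda>_. euclidean) UNIV) (PiE UNIV (\<lambda>_::nat. signs :: 'a set))"
    by (subst compactin_PiE) (auto simp: finite_imp_compact finite_signs)
  then show "compact ?\<Omega>" unfolding eq by (simp add: euclidean_product_topology)
  have "uniform_limit ?\<Omega> (\<lambda>n \<omega>. \<Sum>k<n. \<rho> k *\<^sub>R \<omega> k) (digit_sum \<rho>) sequentially"
    unfolding digit_sum_def[abs_def]
    by (rule Weierstrass_m_test[where M = "\<lambda>k. real DIM('a) * \<rho> k"])
      (use norm_term_le summable_weights[of 0] in \<open>auto intro!: summable_mult\<close>)
  then show "continuous_on ?\<Omega> (digit_sum \<rho>)"
  proof (rule uniform_limit_theorem[rotated])
    have "continuous_on ?\<Omega> (\<lambda>\<omega>. \<omega> k)" for k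
      by (rule continuous_on_subset[OF continuous_on_product_coordinates]) auto
    then show "\<forall>\<^sub>F n in sequentially. continuous_on ?\<Omega> (\<lambda>\<omega>. \<Sum>k<n. \<rho> k *\<^sub>R \<omega> k)"
      by (intro always_eventually allI continuous_intros)
  qed simp
qed

text \<open>The cylinders of length k give a cover by 2^{nk} sets of diameter at most a fixed
  multiple of \<open>\<rho> k\<close>; the assumption \<open>eq\<close> bounds the resulting sums
  uniformly in k.\<close>

lemma hausdorff_digit_set_finite:
  assumes \<alpha>: "0 < \<alpha>" and eq: "\<And>k. 2 ^ (DIM('a) * k) * \<rho> k powr \<alpha> \<le> B"
  shows "hausdorff_dim \<alpha> (digit_sum \<rho> ` {\<omega>. \<forall>j. \<omega> j \<in> (signs :: 'a::euclidean_space set)}) < \<infinity>"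
proof -
  let ?\<Omega> = "{\<omega> :: nat \<Rightarrow> 'a. \<forall>j. \<omega> j \<in> signs}"
  let ?E = "digit_sum \<rho> ` ?\<Omega>"
  define c where "c = 2 * real DIM('a) / (1 - \<theta>)"
  have c: "c \<ge> 0" using \<theta> by (simp add: c_def)
  have "hausdorff_pre (\<lambda>r. r powr \<alpha>) \<delta> ?E \<le> ennreal (c powr \<alpha> * B)" if \<delta>: "\<delta> > 0" for \<delta>
  proof -
    have "(\<lambda>k. c * \<rho> k) \<longlonglongrightarrow> 0" using tendsto_mult_right_zero[OF weights_tendsto_0] .
    from order_tendstoD(2)[OF this \<delta>] obtain k where k: "c * \<rho> k < \<delta>"
      by (auto simp: eventually_sequentially)
    define W where "W = ({..<k} \<rightarrow>\<^sub>E (signs :: 'a set))"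
    have W: "finite W" "card W = 2 ^ (DIM('a) * k)"
      by (auto simp: W_def finite_PiE finite_signs card_PiE card_signs power_mult)
    define Q where "Q w = digit_sum \<rho> ` {\<omega>\<in>?\<Omega>. \<forall>j<k. \<omega> j = w j}" for w
    have Qd: "norm (x - y) \<le> c * \<rho> k" if xy: "x \<in> Q w" "y \<in> Q w" for x y w
    proof -
      obtain \<omega> \<omega>' where *: "\<omega> \<in> ?\<Omega>" "\<omega>' \<in> ?\<Omega>" "\<forall>j<k. \<omega> j = w j" "\<forall>j<k. \<omega>' j = w j"
        "x = digit_sum \<rho> \<omega>" "y = digit_sum \<rho> \<omega>'"
        using xy unfolding Q_def by auto
      then show ?thesis using digit_sum_close[of \<omega> \<omega>' k] by (simp add: c_def)
    qed
    have cr: "0 \<le> c * \<rho> k" using c pos[of k] by simp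
    have Qdiam: "diameter (Q w) \<le> c * \<rho> k" for w
      using Qd cr by (intro diameter_le) auto
    have Qb: "bounded (Q w)" for w
      unfolding bounded_two_points using Qd by (metis dist_norm)
    obtain e where e: "bij_betw e {..<card W} W" using ex_bij_betw_nat_finite[OF W(1)] by (auto simp: atLeast0LessThan)
    \<comment> \<open>Covers are sequences of sets, so the finite cover is padded by empty sets;
      these have diameter 0 and contribute \<open>0 powr \<alpha> = 0\<close>.\<close>
    define C where "C i = (if i < card W then Q (e i) else {})" for i
    have "?E \<subseteq> (\<Union>i. C i)"
    proof
      fix x assume "x \<in> ?E"
      then obtain \<omega> where \<omega>: "\<omega> \<in> ?\<Omega>" "x = digit_sum \<rho> \<omega>" by auto
      have "restrict \<omega> {..<k} \<in> W" using \<omega> by (auto simp: W_def)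
      then obtain i where "i < card W" "e i = restrict \<omega> {..<k}"
        using e by (metis bij_betw_iff_bijections lessThan_iff)
      then have "x \<in> C i" using \<omega> by (auto simp: C_def Q_def)
      then show "x \<in> (\<Union>i. C i)" by blast
    qed
    moreover have "bounded (C i) \<and> diameter (C i) \<le> \<delta>" for i
      using Qb Qdiam[of "e i"] k \<delta> by (auto simp: C_def)
    ultimately have "hausdorff_pre (\<lambda>r. r powr \<alpha>) \<delta> ?E \<le> (\<Sum>i. ennreal (diameter (C i) powr \<alpha>))"
      unfolding hausdorff_pre_def by (intro INF_lower) auto
    also have "\<dots> = (\<Sum>i<card W. ennreal (diameter (C i) powr \<alpha>))"
      by (intro suminf_finite) (auto simp: C_def)
    also have "\<dots> \<le> (\<Sum>i<card W. ennreal ((c * \<rho> k) powr \<alpha>))"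
      using Qdiam \<alpha> Qb by (intro sum_mono ennreal_leI powr_mono2) (auto simp: C_def diameter_ge_0)
    also have "\<dots> = ennreal (c powr \<alpha> * (2 ^ (DIM('a) * k) * \<rho> k powr \<alpha>))"
      using c pos[of k] by (simp add: W ennreal_mult' powr_mult ac_simps flip: ennreal_power)
    also have "\<dots> \<le> ennreal (c powr \<alpha> * B)"
      by (intro ennreal_leI mult_left_mono eq) auto
    finally show ?thesis .
  qed
  then have "hausdorff_dim \<alpha> ?E \<le> ennreal (c powr \<alpha> * B)"
    unfolding hausdorff_gauge_def by (intro SUP_least) auto
  then show ?thesis by (simp add: le_less_trans)
qed

end

subsection \<open>Weak gradients of limits of differentiable maps\<close>

lemma integrable_compact_support:
  fixes g :: "'a::euclidean_space \<Rightarrow> 'b::euclidean_space"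
  assumes "continuous_on UNIV g" and "\<And>x. x \<notin> cball 0 r \<Longrightarrow> g x = 0"
  shows "integrable lborel g"
proof -
  have "integrable lborel (\<lambda>x. indicator (cball 0 r) x *\<^sub>R g x)"
    using assms(1) by (intro borel_integrable_compact) (auto intro: continuous_on_subset)
  also have "(\<lambda>x. indicator (cball 0 r) x *\<^sub>R g x) = g"
    using assms(2) by (fastforce simp: indicator_def)
  finally show ?thesis .
qed

lemma bounded_compact_support:
  fixes g :: "'a::euclidean_space \<Rightarrow> 'b::euclidean_space"
  assumes "continuous_on UNIV g" and "\<And>x. x \<notin> cball 0 r \<Longrightarrow> g x = 0"
  obtains C where "C \<ge> 0" "\<And>x. norm (g x) \<le> C"
proof -
  have "bounded (g ` cball 0 r)"
    using assms(1) by (intro compact_imp_bounded compact_continuous_image) (auto intro: continuous_on_subset)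
  then obtain C where C: "\<And>x. x \<in> cball 0 r \<Longrightarrow> norm (g x) \<le> C"
    unfolding bounded_iff by blast
  have "norm (g x) \<le> max 0 C" for x
    using C[of x] assms(2)[of x] by (cases "x \<in> cball 0 r") auto
  then show ?thesis by (intro that[of "max 0 C"]) auto
qed

lemma derivative_zero_outside_support:
  fixes f :: "'a::real_normed_vector \<Rightarrow> 'b::real_normed_vector"
  assumes f: "(f has_derivative f') (at x)" and K: "closed K" "x \<notin> K" "\<And>y. y \<notin> K \<Longrightarrow> f y = 0"
  shows "f' = (\<lambda>_. 0)"
proof -
  have "(f has_derivative (\<lambda>_. 0)) (at x)"
    by (rule has_derivative_transform_within_open[OF has_derivative_const[of 0], where s = "- K"]) (use K in auto)
  with f show ?thesis by (rule has_derivative_unique)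
qed

text \<open>By translation invariance the difference quotients have integral zero, and they converge
  dominatedly to the derivative.\<close>

lemma integral_derivative_compact_support:
  fixes f :: "'a::euclidean_space \<Rightarrow> 'b::euclidean_space"
  assumes der: "\<And>x. (f has_derivative f' x) (at x)"
    and cont: "continuous_on UNIV (\<lambda>x. f' x v)"
    and supp: "\<And>x. x \<notin> cball 0 r \<Longrightarrow> f x = 0"
  shows "(LINT x|lborel. f' x v) = 0"
proof -
  have supp': "f' x v = 0" if "x \<notin> cball 0 r" for x
    using derivative_zero_outside_support[OF der closed_cball that supp] by simp
  obtain C where C: "C \<ge> 0" "\<And>x. norm (f' x v) \<le> C"
    using bounded_compact_support[OF cont supp'] by blast
  have fcont: "continuous_on UNIV f"
    by (intro continuous_at_imp_continuous_on ballI has_derivative_continuous[OF der])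
  have fint: "integrable lborel f" by (rule integrable_compact_support[OF fcont supp])
  \<comment> \<open>Steps of at most 1 keep the supports of all difference quotients inside the
    single ball of radius \<open>r + norm v\<close>.\<close>
  define h where "h m = 1 / real (Suc m)" for m
  have h: "0 < h m" "h m \<le> 1" for m by (auto simp: h_def)
  have line: "((\<lambda>t. f (x + t *\<^sub>R v)) has_vector_derivative f' (x + t *\<^sub>R v) v) (at t within T)" for x t T
  proof -
    have "((\<lambda>t. x + t *\<^sub>R v) has_vector_derivative v) (at t within T)"
      by (auto intro!: derivative_eq_intros)
    then have "((f \<circ> (\<lambda>t. x + t *\<^sub>R v)) has_vector_derivative f' (x + t *\<^sub>R v) v) (at t within T)"
      by (rule vector_derivative_diff_chain_within) (auto intro: has_derivative_at_withinI der)
    then show ?thesis by (simp add: o_def)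
  qed
  define q where "q m x = (1 / h m) *\<^sub>R (f (x + h m *\<^sub>R v) - f x)" for m x
  have q_int: "(LINT x|lborel. q m x) = 0" for m
  proof -
    have "integrable lborel (\<lambda>x. f (h m *\<^sub>R v + x))"
      by (subst integrable_distr_eq[symmetric, where N = borel and M = lborel])
        (use fint in \<open>auto simp: lborel_distr_plus\<close>)
    moreover have "(LINT x|lborel. f (h m *\<^sub>R v + x)) = (LINT x|lborel. f x)"
    proof -
      have "(LINT x|lborel. f x) = (LINT x|distr lborel borel ((+) (h m *\<^sub>R v)). f x)"
        by (simp add: lborel_distr_plus)
      also have "\<dots> = (LINT x|lborel. f (h m *\<^sub>R v + x))"
        using fcont by (intro integral_distr) (auto intro: borel_measurable_continuous_onI)
      finally show ?thesis by simp
    qed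
    ultimately show ?thesis unfolding q_def using fint by (simp add: add.commute)
  qed
  have q_bd: "norm (q m x) \<le> indicator (cball 0 (r + norm v)) x * C" for m x
  proof (cases "x \<in> cball 0 (r + norm v)")
    case True
    have "norm (f (x + h m *\<^sub>R v) - f (x + 0 *\<^sub>R v)) \<le> C * norm (h m - 0)"
    proof (rule differentiable_bound[where S = UNIV and f' = "\<lambda>t k. k *\<^sub>R f' (x + t *\<^sub>R v) v"])
      show "onorm (\<lambda>k. k *\<^sub>R f' (x + t *\<^sub>R v) v) \<le> C" for t :: real
        by (rule onorm_le) (use C(2) in \<open>simp add: mult.commute[of C] mult_left_mono\<close>)
    qed (use line in \<open>auto simp: has_vector_derivative_def\<close>)
    then show ?thesis using True h[of m] by (simp add: q_def divide_simps mult.commute)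
  next
    case False
    then have x: "norm x > r + norm v" by simp
    have "norm x \<le> norm (x + h m *\<^sub>R v) + h m * norm v"
      using norm_triangle_ineq4[of "x + h m *\<^sub>R v" "h m *\<^sub>R v"] h[of m] by simp
    moreover have "h m * norm v \<le> 1 * norm v" using h[of m] by (intro mult_right_mono) auto
    ultimately have "norm (x + h m *\<^sub>R v) > r" using x by linarith
    moreover have "norm x > r" using x norm_ge_zero[of v] by linarith
    ultimately show ?thesis using supp False by (simp add: q_def)
  qed
  have q_lim: "(\<lambda>m. q m x) \<longlonglongrightarrow> f' x v" for x
  proof -
    have "((\<lambda>t. f (x + t *\<^sub>R v)) has_vector_derivative f' x v) (at 0)"
      using line[of x 0 UNIV] by simp
    then have "((\<lambda>t. (f (x + t *\<^sub>R v) - f x) /\<^sub>R t) \<longlongrightarrow> f' x v) (at 0)"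
    proof -
      assume "((\<lambda>t. f (x + t *\<^sub>R v)) has_vector_derivative f' x v) (at 0)"
      then have "((\<lambda>t. norm (f (x + t *\<^sub>R v) - f x - t *\<^sub>R f' x v) / norm t) \<longlongrightarrow> 0) (at 0)"
        by (simp add: has_vector_derivative_def has_derivative_at)
      moreover have "norm (f (x + t *\<^sub>R v) - f x - t *\<^sub>R f' x v) / norm t = norm ((f (x + t *\<^sub>R v) - f x) /\<^sub>R t - f' x v)"
        if "t \<noteq> 0" for t
      proof -
        have "(f (x + t *\<^sub>R v) - f x) /\<^sub>R t - f' x v = (f (x + t *\<^sub>R v) - f x - t *\<^sub>R f' x v) /\<^sub>R t"
          using that by (simp add: scaleR_diff_right)
        then show ?thesis by (simp add: divide_inverse mult.commute)
      qed
      then have "\<forall>\<^sub>F t in at 0. norm (f (x + t *\<^sub>R v) - f x - t *\<^sub>R f' x v) / norm t = norm ((f (x + t *\<^sub>R v) - f x) /\<^sub>R t - f' x v)"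
        by (auto simp: eventually_at_filter)
      ultimately have "((\<lambda>t. norm ((f (x + t *\<^sub>R v) - f x) /\<^sub>R t - f' x v)) \<longlongrightarrow> 0) (at 0)"
        by (rule Lim_transform_eventually)
      then show ?thesis by (simp add: tendsto_norm_zero_iff LIM_zero_cancel)
    qed
    moreover have "filterlim h (at 0) sequentially"
      using h LIMSEQ_Suc[OF lim_1_over_n] by (auto simp: filterlim_at h_def[abs_def] intro!: always_eventually)
    ultimately have "((\<lambda>m. (f (x + h m *\<^sub>R v) - f x) /\<^sub>R h m) \<longlonglongrightarrow> f' x v)"
      by (rule filterlim_compose)
    then show ?thesis by (simp add: q_def divide_inverse)
  qed
  have "(\<lambda>m. LINT x|lborel. q m x) \<longlonglongrightarrow> (LINT x|lborel. f' x v)"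
  proof (rule integral_dominated_convergence[where w = "\<lambda>x. indicator (cball 0 (r + norm v)) x * C"])
    show "integrable lborel (\<lambda>x::'a. indicator (cball 0 (r + norm v)) x * C)"
      by (intro integrable_mult_left integrable_real_indicator) (use emeasure_bounded_finite[OF bounded_cball] in auto)
    show "q m \<in> borel_measurable lborel" for m
      unfolding q_def using fcont
      by (auto intro!: borel_measurable_continuous_onI continuous_intros continuous_on_compose2[OF fcont])
  qed (use q_lim q_bd borel_measurable_continuous_onI[OF cont] in auto)
  then show ?thesis by (simp add: q_int LIMSEQ_const_iff)
qed

text \<open>Extracts the first-order content of smoothness: the empty word of partial derivatives
  gives differentiability of \<open>\<psi>\<close>, and words of length one give differentiable,
  hence continuous, partials.\<close>

lemma test_fun_C1:
  fixes \<psi> :: "'a::euclidean_space \<Rightarrow> real"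
  assumes "test_fun \<psi>"
  obtains r where "\<And>x. (\<psi> has_derivative frechet_derivative \<psi> (at x)) (at x)"
    and "\<And>i. i \<in> Basis \<Longrightarrow> continuous_on UNIV (pderiv_dir i \<psi>)"
    and "\<And>x. x \<notin> cball 0 r \<Longrightarrow> \<psi> x = 0" "\<And>x i. x \<notin> cball 0 r \<Longrightarrow> pderiv_dir i \<psi> x = 0"
proof -
  have sm: "set ds \<subseteq> Basis \<Longrightarrow> (foldr pderiv_dir ds \<psi>) differentiable (at x)" for ds x
    using assms by (auto simp: test_fun_def smooth_fun_def)
  have der: "(\<psi> has_derivative frechet_derivative \<psi> (at x)) (at x)" for x
    using sm[of "[]" x] by (simp add: frechet_derivative_works)
  have cont: "continuous_on UNIV (pderiv_dir i \<psi>)" if "i \<in> Basis" for i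
    using sm[of "[i]"] that
    by (intro continuous_at_imp_continuous_on ballI differentiable_imp_continuous_within) auto
  have "bounded (closure {x. \<psi> x \<noteq> 0})" using assms by (simp add: test_fun_def compact_imp_bounded)
  then obtain r where r: "\<And>x. x \<in> closure {x. \<psi> x \<noteq> 0} \<Longrightarrow> norm x \<le> r" by (auto simp: bounded_iff)
  have supp: "\<psi> x = 0" if "x \<notin> cball 0 r" for x
    using r[of x] that closure_subset[of "{x. \<psi> x \<noteq> 0}"] by auto
  have "pderiv_dir i \<psi> x = 0" if "x \<notin> cball 0 r" for x i
    using derivative_zero_outside_support[OF der closed_cball that supp] by (simp add: pderiv_dir_def)
  then show ?thesis by (intro that[of r] der cont supp)
qed

text \<open>The product of \<open>\<psi>\<close> and \<open>f\<close> inherits compact support from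
  \<open>\<psi>\<close>, so the integral of its directional derivative vanishes; the product rule
  splits it.\<close>

lemma integration_by_parts_test_fun:
  fixes f :: "'a::euclidean_space \<Rightarrow> 'b::euclidean_space"
  assumes der: "\<And>x. (f has_derivative f' x) (at x)"
    and cont: "continuous_on UNIV (\<lambda>x. f' x i)" and i: "i \<in> Basis" and \<psi>: "test_fun \<psi>"
  shows "(LINT x|lborel. pderiv_dir i \<psi> x *\<^sub>R f x) = - (LINT x|lborel. \<psi> x *\<^sub>R f' x i)"
proof -
  obtain r where r: "\<And>x. (\<psi> has_derivative frechet_derivative \<psi> (at x)) (at x)"
    "\<And>i. i \<in> Basis \<Longrightarrow> continuous_on UNIV (pderiv_dir i \<psi>)"
    "\<And>x. x \<notin> cball 0 r \<Longrightarrow> \<psi> x = 0" "\<And>x i. x \<notin> cball 0 r \<Longrightarrow> pderiv_dir i \<psi> x = 0"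
    using test_fun_C1[OF \<psi>] by metis
  have fc: "continuous_on UNIV f"
    by (intro continuous_at_imp_continuous_on ballI has_derivative_continuous[OF der])
  have \<psi>c: "continuous_on UNIV \<psi>"
    by (intro continuous_at_imp_continuous_on ballI has_derivative_continuous[OF r(1)])
  have int1: "integrable lborel (\<lambda>x. pderiv_dir i \<psi> x *\<^sub>R f x)"
    by (rule integrable_compact_support[where r = r]) (auto intro!: continuous_intros r(2) fc i simp: r(4))
  have int2: "integrable lborel (\<lambda>x. \<psi> x *\<^sub>R f' x i)"
    by (rule integrable_compact_support[where r = r]) (auto intro!: continuous_intros \<psi>c cont simp: r(3))
  have "(LINT x|lborel. (\<lambda>v. \<psi> x *\<^sub>R f' x v + frechet_derivative \<psi> (at x) v *\<^sub>R f x) i) = 0"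
  proof (rule integral_derivative_compact_support)
    show "((\<lambda>x. \<psi> x *\<^sub>R f x) has_derivative (\<lambda>v. \<psi> x *\<^sub>R f' x v + frechet_derivative \<psi> (at x) v *\<^sub>R f x)) (at x)" for x
      by (rule has_derivative_scaleR[OF r(1) der])
    show "continuous_on UNIV (\<lambda>x. \<psi> x *\<^sub>R f' x i + frechet_derivative \<psi> (at x) i *\<^sub>R f x)"
      using r(2)[OF i] unfolding pderiv_dir_def[abs_def] by (intro continuous_intros \<psi>c cont fc)
    show "\<And>x. x \<notin> cball 0 r \<Longrightarrow> \<psi> x *\<^sub>R f x = 0" using r(3) by simp
  qed
  then have "(LINT x|lborel. \<psi> x *\<^sub>R f' x i + pderiv_dir i \<psi> x *\<^sub>R f x) = 0"
    by (simp add: pderiv_dir_def)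
  then show ?thesis using int1 int2 by (simp add: add_eq_0_iff)
qed

text \<open>Both sides of the integration by parts pass to the limit by dominated convergence.
  Domination of \<open>DU\<close> by the limit \<open>G\<close> itself fits sums of gradients with
  disjoint supports, whose partial sums agree with \<open>G\<close> or vanish. Compact support of
  \<open>\<psi>\<close> makes local integrability of \<open>G\<close> sufficient.\<close>

lemma weak_gradient_limit:
  fixes U :: "nat \<Rightarrow> 'a::euclidean_space \<Rightarrow> 'b::euclidean_space"
  assumes der: "\<And>m x. (U m has_derivative DU m x) (at x)"
    and cont: "\<And>m i. i \<in> Basis \<Longrightarrow> continuous_on UNIV (\<lambda>x. DU m x i)"
    and lim: "\<And>x. (\<lambda>m. U m x) \<longlonglongrightarrow> u x" and bd: "\<And>m x. norm (U m x) \<le> K"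
    and limG: "\<And>x i. i \<in> Basis \<Longrightarrow> (\<lambda>m. DU m x i) \<longlonglongrightarrow> G x i"
    and dom: "\<And>m x i. i \<in> Basis \<Longrightarrow> norm (DU m x i) \<le> norm (G x i)"
    and G: "\<And>i. i \<in> Basis \<Longrightarrow> locally_integrable (\<lambda>x. G x i)"
    and u: "u \<in> borel_measurable lborel"
  shows "weak_gradient u G"
  unfolding weak_gradient_def
proof (intro ballI conjI allI impI)
  fix i :: 'a and \<psi> :: "'a \<Rightarrow> real" assume i: "i \<in> Basis" and \<psi>: "test_fun \<psi>"
  obtain r where r: "\<And>x. (\<psi> has_derivative frechet_derivative \<psi> (at x)) (at x)"
    "\<And>i. i \<in> Basis \<Longrightarrow> continuous_on UNIV (pderiv_dir i \<psi>)"
    "\<And>x. x \<notin> cball 0 r \<Longrightarrow> \<psi> x = 0" "\<And>x i. x \<notin> cball 0 r \<Longrightarrow> pderiv_dir i \<psi> x = 0"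
    using test_fun_C1[OF \<psi>] by metis
  have \<psi>c: "continuous_on UNIV \<psi>"
    by (intro continuous_at_imp_continuous_on ballI has_derivative_continuous[OF r(1)])
  have Uc: "continuous_on UNIV (U m)" for m
    by (intro continuous_at_imp_continuous_on ballI has_derivative_continuous[OF der])
  obtain C where C: "C \<ge> 0" "\<And>x. norm (\<psi> x) \<le> C"
    using bounded_compact_support[OF \<psi>c r(3)] by blast
  note [measurable] = borel_measurable_continuous_onI[OF \<psi>c] borel_measurable_continuous_onI[OF r(2)[OF i]]
    borel_measurable_continuous_onI[OF Uc] borel_measurable_continuous_onI[OF cont[OF i]]
  have [measurable]: "(\<lambda>x. G x i) \<in> borel_measurable lborel" using G[OF i] by (simp add: locally_integrable_def)
  note [measurable] = u
  have lim1: "(\<lambda>m. LINT x|lborel. pderiv_dir i \<psi> x *\<^sub>R U m x) \<longlonglongrightarrow> (LINT x|lborel. pderiv_dir i \<psi> x *\<^sub>R u x)"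
  proof (rule integral_dominated_convergence[where w = "\<lambda>x. norm (pderiv_dir i \<psi> x) * K"])
    show "integrable lborel (\<lambda>x. norm (pderiv_dir i \<psi> x) * K)"
      by (intro integrable_mult_left integrable_norm integrable_compact_support[OF r(2)[OF i] r(4)]) auto
    show "AE x in lborel. norm (pderiv_dir i \<psi> x *\<^sub>R U m x) \<le> norm (pderiv_dir i \<psi> x) * K" for m
      using bd by (auto intro!: mult_left_mono)
    show "AE x in lborel. (\<lambda>m. pderiv_dir i \<psi> x *\<^sub>R U m x) \<longlonglongrightarrow> pderiv_dir i \<psi> x *\<^sub>R u x"
      using lim by (auto intro!: tendsto_intros)
  qed measurable
  have lim2: "(\<lambda>m. LINT x|lborel. \<psi> x *\<^sub>R DU m x i) \<longlonglongrightarrow> (LINT x|lborel. \<psi> x *\<^sub>R G x i)"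
  proof (rule integral_dominated_convergence[where w = "\<lambda>x. C * norm (indicator (cball 0 r) x *\<^sub>R G x i)"])
    show "integrable lborel (\<lambda>x. C * norm (indicator (cball 0 r) x *\<^sub>R G x i))"
      using G[OF i] unfolding locally_integrable_def set_integrable_def
      by (intro integrable_mult_right integrable_norm) auto
    show "AE x in lborel. norm (\<psi> x *\<^sub>R DU m x i) \<le> C * norm (indicator (cball 0 r) x *\<^sub>R G x i)" for m
    proof (rule AE_I2)
      fix x show "norm (\<psi> x *\<^sub>R DU m x i) \<le> C * norm (indicator (cball 0 r) x *\<^sub>R G x i)"
        using dom[OF i, of m x] C r(3)[of x] by (cases "x \<in> cball 0 r") (auto intro!: mult_mono)
    qed
    show "AE x in lborel. (\<lambda>m. \<psi> x *\<^sub>R DU m x i) \<longlonglongrightarrow> \<psi> x *\<^sub>R G x i"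
      using limG[OF i] by (auto intro!: tendsto_intros)
  qed measurable
  have "(LINT x|lborel. pderiv_dir i \<psi> x *\<^sub>R U m x) = - (LINT x|lborel. \<psi> x *\<^sub>R DU m x i)" for m
    by (rule integration_by_parts_test_fun[OF der cont[OF i] i \<psi>])
  with lim1 tendsto_minus[OF lim2]
  show "(LINT x|lborel. pderiv_dir i \<psi> x *\<^sub>R u x) = - (LINT x|lborel. \<psi> x *\<^sub>R G x i)"
    using LIMSEQ_unique by auto
qed (use G in auto)

subsection \<open>Maps reading off the digits\<close>

text \<open>Squaring the positive part makes the truncation at 0 continuously differentiable, which
  is the regularity the integration by parts asks for.\<close>

definition pos_sq :: "real \<Rightarrow> real" where "pos_sq y = (max 0 y)\<^sup>2"

lemma pos_sq_deriv: "(pos_sq has_real_derivative 2 * max 0 y) (at y)"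
proof -
  consider "y > 0" | "y < 0" | "y = 0" by linarith
  then show ?thesis
  proof cases
    case 1
    have "((\<lambda>y. y\<^sup>2) has_real_derivative 2 * max 0 y) (at y)"
      using 1 by (auto intro!: derivative_eq_intros)
    then show ?thesis
      by (rule has_field_derivative_transform_within_open[where S = "{0<..}"]) (use 1 in \<open>auto simp: pos_sq_def\<close>)
  next
    case 2
    have "((\<lambda>y. 0) has_real_derivative 2 * max 0 y) (at y)" using 2 by simp
    then show ?thesis
      by (rule has_field_derivative_transform_within_open[where S = "{..<0}"]) (use 2 in \<open>auto simp: pos_sq_def\<close>)
  next
    case 3
    have "((\<lambda>h. pos_sq h / h) \<longlongrightarrow> 0) (at 0)"
    proof (rule Lim_null_comparison)
      show "\<forall>\<^sub>F h in at 0. norm (pos_sq h / h) \<le> \<bar>h\<bar>"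
        by (auto simp: pos_sq_def max_def power2_eq_square intro!: always_eventually)
      show "((\<lambda>h. \<bar>h\<bar>) \<longlongrightarrow> (0::real)) (at 0)" by (auto intro!: tendsto_eq_intros)
    qed
    then show ?thesis using 3 by (simp add: DERIV_def pos_sq_def)
  qed
qed

lemma pos_sq_nonneg: "0 \<le> pos_sq y" by (simp add: pos_sq_def)

lemma pos_sq_le_1: "y \<le> 1 \<Longrightarrow> pos_sq y \<le> 1" by (simp add: pos_sq_def power_le_one)

lemma pos_sq_eq_0: "y \<le> 0 \<Longrightarrow> pos_sq y = 0" by (simp add: pos_sq_def)

lemma pos_sq_ge_1: "1 \<le> y \<Longrightarrow> 1 \<le> pos_sq y" by (simp add: pos_sq_def)

lemma continuous_pos_sq: "continuous_on S pos_sq"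
  unfolding pos_sq_def[abs_def] by (intro continuous_intros)

locale cantor_ratio =
  fixes l :: real
  assumes l: "0 < l" "l < 1/2"
begin

text \<open>Normalised to be 0 at 1/2 in absolute value and 1 at \<open>l\<close>; using the square
  of t avoids the corner of the absolute value.\<close>

definition ramp :: "real \<Rightarrow> real" where
  "ramp t = (1/4 - t\<^sup>2) / (1/4 - l\<^sup>2)"

text \<open>The inner \<open>pos_sq\<close> cuts \<open>ramp\<close> off below 0 and the outer one
  cuts it off above 1, both without losing a continuous derivative.\<close>

definition plateau :: "real \<Rightarrow> real" where
  "plateau t = 1 - pos_sq (1 - pos_sq (ramp t))"

definition dplateau :: "real \<Rightarrow> real" where
  "dplateau t = 2 * max 0 (1 - pos_sq (ramp t)) * (2 * max 0 (ramp t) * (- 2 * t / (1/4 - l\<^sup>2)))"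

lemma ramp_denom: "0 < 1/4 - l\<^sup>2"
  using power_strict_mono[of l "1/2" 2] l by (simp add: power2_eq_square)

lemma ramp_le_0: "1/2 \<le> \<bar>t\<bar> \<Longrightarrow> ramp t \<le> 0"
  using power_mono[of "1/2" "\<bar>t\<bar>" 2] ramp_denom by (simp add: ramp_def power2_eq_square divide_le_0_iff)

lemma ramp_ge_1: "\<bar>t\<bar> \<le> l \<Longrightarrow> 1 \<le> ramp t"
  using power_mono[of "\<bar>t\<bar>" l 2] ramp_denom by (simp add: ramp_def)

lemma plateau_deriv: "(plateau has_real_derivative dplateau t) (at t)"
proof -
  have r: "(ramp has_real_derivative (- 2 * t / (1/4 - l\<^sup>2))) (at t)"
    unfolding ramp_def[abs_def] by (intro DERIV_cdivide) (auto intro!: derivative_eq_intros)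
  have "((\<lambda>t. 1 - pos_sq (ramp t)) has_real_derivative - (2 * max 0 (ramp t) * (- 2 * t / (1/4 - l\<^sup>2)))) (at t)"
    using DERIV_diff[OF DERIV_const[of 1] DERIV_chain2[OF pos_sq_deriv r]] by simp
  from DERIV_diff[OF DERIV_const[of 1] DERIV_chain2[OF pos_sq_deriv this]]
  show ?thesis unfolding plateau_def[abs_def] dplateau_def by simp
qed

lemma continuous_plateau: "continuous_on S plateau"
  by (intro continuous_at_imp_continuous_on ballI DERIV_isCont[OF plateau_deriv])

lemma continuous_dplateau: "continuous_on S dplateau"
proof -
  have r: "continuous_on S ramp" unfolding ramp_def[abs_def] using ramp_denom by (intro continuous_intros) auto
  show ?thesis unfolding dplateau_def[abs_def] using ramp_denom
    by (intro continuous_intros continuous_on_compose2[OF continuous_pos_sq[of UNIV]] r) auto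
qed

lemma plateau_range: "0 \<le> plateau t" "plateau t \<le> 1"
  using pos_sq_le_1[of "1 - pos_sq (ramp t)"] pos_sq_nonneg by (auto simp: plateau_def)

lemma plateau_outside: "1/2 \<le> \<bar>t\<bar> \<Longrightarrow> plateau t = 0" "1/2 \<le> \<bar>t\<bar> \<Longrightarrow> dplateau t = 0"
  using ramp_le_0[of t] by (simp_all add: plateau_def dplateau_def pos_sq_eq_0 max_def) (simp_all add: pos_sq_def)

lemma plateau_inside: "\<bar>t\<bar> \<le> l \<Longrightarrow> plateau t = 1" "\<bar>t\<bar> \<le> l \<Longrightarrow> dplateau t = 0"
  using pos_sq_ge_1[OF ramp_ge_1[of t]] by (auto simp: plateau_def dplateau_def pos_sq_eq_0)

definition bump :: "'a::euclidean_space \<Rightarrow> real" where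
  "bump x = (\<Prod>i\<in>Basis. plateau (x \<bullet> i))"

definition dbump :: "'a::euclidean_space \<Rightarrow> 'a \<Rightarrow> real" where
  "dbump x v = (\<Sum>i\<in>Basis. (dplateau (x \<bullet> i) * (v \<bullet> i)) * (\<Prod>j\<in>Basis - {i}. plateau (x \<bullet> j)))"

lemma bump_deriv: "(bump has_derivative dbump x) (at x)"
proof -
  have "((\<lambda>x. plateau (x \<bullet> i)) has_derivative (\<lambda>v. dplateau (x \<bullet> i) * (v \<bullet> i))) (at x)" for i
    using has_derivative_compose[OF has_derivative_inner_left[OF has_derivative_ident]
        plateau_deriv[of "x \<bullet> i", unfolded has_field_derivative_def]] by (simp add: o_def)
  then show ?thesis
    unfolding bump_def[abs_def] dbump_def[abs_def] by (intro has_derivative_prod)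
qed

lemma continuous_dbump: "continuous_on S (\<lambda>x. dbump x v)"
  unfolding dbump_def
  by (intro continuous_intros continuous_on_compose2[OF continuous_plateau[of UNIV]]
      continuous_on_compose2[OF continuous_dplateau[of UNIV]]) auto

lemma bump_range: "0 \<le> bump x" "bump x \<le> 1"
  using plateau_range by (auto simp: bump_def intro!: prod_nonneg prod_le_1)

lemma bump_outside:
  assumes "i \<in> Basis" "1/2 \<le> \<bar>x \<bullet> i\<bar>"
  shows "bump x = 0" "dbump x v = 0"
proof -
  have p: "plateau (x \<bullet> i) = 0" "dplateau (x \<bullet> i) = 0" using plateau_outside assms by auto
  show "bump x = 0" unfolding bump_def using assms p by (auto intro!: prod_zero)
  show "dbump x v = 0" unfolding dbump_def
  proof (rule sum.neutral, rule ballI)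
    fix j :: 'a assume j: "j \<in> Basis"
    show "(dplateau (x \<bullet> j) * (v \<bullet> j)) * (\<Prod>k\<in>Basis - {j}. plateau (x \<bullet> k)) = 0"
    proof (cases "j = i")
      case True then show ?thesis using p by simp
    next
      case False
      then have "(\<Prod>k\<in>Basis - {j}. plateau (x \<bullet> k)) = 0"
        using assms p by (intro prod_zero) auto
      then show ?thesis by simp
    qed
  qed
qed

lemma bump_inside:
  assumes "\<And>i. i \<in> Basis \<Longrightarrow> \<bar>x \<bullet> i\<bar> \<le> l"
  shows "bump x = 1" "dbump x v = 0"
  using assms plateau_inside by (auto simp: bump_def dbump_def)

section \<open>Self-similar digit maps and their gradients\<close>

text \<open>The inverse of the Cantor similarity y -> s/2 + l y; a first-generation cube is the
  preimage of \<open>cube\<close> under it.\<close>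

definition zoom :: "'a::euclidean_space \<Rightarrow> 'a \<Rightarrow> 'a" where
  "zoom s x = (1 / l) *\<^sub>R (x - (1/2) *\<^sub>R s)"

definition cube :: "'a::euclidean_space set" where
  "cube = {x. \<forall>i\<in>Basis. \<bar>x \<bullet> i\<bar> < 1}"

text \<open>In the recursive step at most one summand is nonzero, since \<open>level k\<close>
  vanishes off \<open>cube\<close> and the first-generation cubes are disjoint. Writing a sum
  instead of a case distinction makes differentiability immediate.\<close>

fun level :: "nat \<Rightarrow> 'a::euclidean_space \<Rightarrow> 'a" where
  "level 0 x = (\<Sum>s\<in>signs. bump (x - (1/2) *\<^sub>R s) *\<^sub>R s)"
| "level (Suc k) x = (\<Sum>s\<in>signs. level k (zoom s x))"

fun dlevel :: "nat \<Rightarrow> 'a::euclidean_space \<Rightarrow> 'a \<Rightarrow> 'a" where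
  "dlevel 0 x v = (\<Sum>s\<in>signs. dbump (x - (1/2) *\<^sub>R s) v *\<^sub>R s)"
| "dlevel (Suc k) x v = (\<Sum>s\<in>signs. (1 / l) *\<^sub>R dlevel k (zoom s x) v)"

lemma level_deriv: "(level k has_derivative dlevel k x) (at x)" for x :: "'a::euclidean_space"
proof (induction k arbitrary: x)
  case 0
  have "((\<lambda>x. bump (x - (1/2) *\<^sub>R s) *\<^sub>R s) has_derivative (\<lambda>v. dbump (x - (1/2) *\<^sub>R s) v *\<^sub>R s)) (at x)" for s :: 'a
  proof -
    have "((\<lambda>x. x - (1/2) *\<^sub>R s) has_derivative (\<lambda>v. v)) (at x)" by (auto intro!: derivative_eq_intros)
    from has_derivative_compose[OF this bump_deriv] show ?thesis
      by (intro has_derivative_scaleR_left) (simp add: o_def)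
  qed
  then show ?case unfolding level.simps[abs_def] dlevel.simps[abs_def] by (intro has_derivative_sum)
next
  case (Suc k)
  have "((\<lambda>x. level k (zoom s x)) has_derivative (\<lambda>v. (1 / l) *\<^sub>R dlevel k (zoom s x) v)) (at x)" for s :: 'a
  proof -
    have "(zoom s has_derivative (\<lambda>v. (1 / l) *\<^sub>R v)) (at x)"
      unfolding zoom_def[abs_def] by (auto intro!: derivative_eq_intros)
    from has_derivative_compose[OF this Suc] show ?thesis
      using linear_cmul[OF has_derivative_linear[OF Suc]] by (simp add: o_def)
  qed
  then show ?case unfolding level.simps[abs_def] dlevel.simps[abs_def] by (intro has_derivative_sum)
qed

lemma continuous_level: "continuous_on S (level k)"
  by (intro continuous_at_imp_continuous_on ballI has_derivative_continuous[OF level_deriv])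

lemma continuous_dlevel: "continuous_on UNIV (\<lambda>x. dlevel k x v)"
proof (induction k)
  case 0
  show ?case unfolding dlevel.simps
    by (intro continuous_intros continuous_on_compose2[OF continuous_dbump[of UNIV]]) auto
next
  case (Suc k)
  show ?case unfolding dlevel.simps zoom_def
    by (intro continuous_intros continuous_on_compose2[OF Suc]) auto
qed

lemma zoom_inner: "zoom s x \<bullet> i = (x \<bullet> i - (s \<bullet> i) / 2) / l"
  by (simp add: zoom_def inner_diff_left)

lemma zoom_in_cubeD:
  assumes "zoom s x \<in> cube" "i \<in> Basis"
  shows "\<bar>x \<bullet> i - (s \<bullet> i) / 2\<bar> < l"
  using assms l by (auto simp: cube_def zoom_inner abs_divide)

text \<open>In a coordinate where the signs differ the two centres are at distance 1, more than
  2\<open>l\<close>.\<close>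

lemma zoom_in_cube_unique:
  assumes "s \<in> signs" "t \<in> signs" "zoom s x \<in> cube" "zoom t x \<in> cube"
  shows "s = t"
proof (rule euclidean_eqI)
  fix i :: 'a assume i: "i \<in> Basis"
  have "s \<bullet> i = 1 \<or> s \<bullet> i = -1" "t \<bullet> i = 1 \<or> t \<bullet> i = -1"
    using assms(1,2) i by (auto simp: signs_def)
  then show "s \<bullet> i = t \<bullet> i"
    using zoom_in_cubeD[OF assms(3) i] zoom_in_cubeD[OF assms(4) i] l by auto
qed

lemma zoom_outside:
  assumes "x \<notin> cube" "s \<in> signs"
  shows "zoom s x \<notin> cube"
proof
  assume z: "zoom s x \<in> cube"
  obtain i where i: "i \<in> Basis" "1 \<le> \<bar>x \<bullet> i\<bar>" using assms(1) by (force simp: cube_def not_less)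
  show False
    using zoom_in_cubeD[OF z i(1)] abs_signs[OF assms(2) i(1)] i(2) l by auto
qed

lemma bump_shift_outside:
  assumes "x \<notin> cube" "s \<in> signs"
  shows "bump (x - (1/2) *\<^sub>R s) = 0" "dbump (x - (1/2) *\<^sub>R s) v = 0"
proof -
  obtain i where i: "i \<in> Basis" "1 \<le> \<bar>x \<bullet> i\<bar>" using assms(1) by (force simp: cube_def not_less)
  have "1/2 \<le> \<bar>(x - (1/2) *\<^sub>R s) \<bullet> i\<bar>"
    using abs_triangle_ineq2[of "x \<bullet> i" "(s \<bullet> i) / 2"] abs_signs[OF assms(2) i(1)] i(2)
    by (simp add: inner_diff_left)
  then show "bump (x - (1/2) *\<^sub>R s) = 0" "dbump (x - (1/2) *\<^sub>R s) v = 0"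
    using bump_outside[OF i(1)] by auto
qed

lemma level_outside: "x \<notin> cube \<Longrightarrow> level k x = 0"
  and dlevel_outside: "x \<notin> cube \<Longrightarrow> dlevel k x v = 0" for x :: "'a::euclidean_space"
proof (induction k arbitrary: x)
  case 0
  { case 1 then show ?case by (simp add: bump_shift_outside)
  next case 2 then show ?case by (simp add: bump_shift_outside) }
next
  case (Suc k)
  { case 1 then show ?case using Suc(1) by (simp add: zoom_outside)
  next case 2 then show ?case using Suc(2) by (simp add: zoom_outside) }
qed

lemma level_Suc_zoom:
  assumes s: "s \<in> signs" "zoom s x \<in> cube"
  shows "level (Suc k) x = level k (zoom s x)" "dlevel (Suc k) x v = (1 / l) *\<^sub>R dlevel k (zoom s x) v"
proof -
  have z: "zoom t x \<notin> cube" if "t \<in> signs - {s}" for t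
    using zoom_in_cube_unique[OF s(1) _ s(2), of t] that by auto
  have "level (Suc k) x = level k (zoom s x) + (\<Sum>t\<in>signs - {s}. level k (zoom t x))"
    using s by (simp add: sum.remove[OF finite_signs])
  then show "level (Suc k) x = level k (zoom s x)" using z by (simp add: level_outside)
  have "dlevel (Suc k) x v = (1 / l) *\<^sub>R dlevel k (zoom s x) v + (\<Sum>t\<in>signs - {s}. (1 / l) *\<^sub>R dlevel k (zoom t x) v)"
    using s by (simp add: sum.remove[OF finite_signs])
  then show "dlevel (Suc k) x v = (1 / l) *\<^sub>R dlevel k (zoom s x) v" using z by (simp add: dlevel_outside)
qed

lemma level_Suc_no_zoom:
  assumes "\<And>s. s \<in> signs \<Longrightarrow> zoom s x \<notin> cube"
  shows "level (Suc k) x = 0" "dlevel (Suc k) x v = 0"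
  using assms by (simp_all add: level_outside dlevel_outside)

lemma norm_level_le: "norm (level k x) \<le> 2 ^ DIM('a) * real DIM('a)" for x :: "'a::euclidean_space"
proof (induction k arbitrary: x)
  case 0
  have "norm (level 0 x) \<le> (\<Sum>s\<in>(signs :: 'a set). 1 * real DIM('a))"
    unfolding level.simps
  proof (rule sum_norm_le)
    fix s :: 'a assume s: "s \<in> signs"
    show "norm (bump (x - (1/2) *\<^sub>R s) *\<^sub>R s) \<le> 1 * real DIM('a)"
      unfolding norm_scaleR using norm_signs_le[OF s] by (intro mult_mono) (auto simp: bump_range)
  qed
  then show ?case by (simp add: card_signs)
next
  case (Suc k)
  then show ?case
    using level_Suc_zoom(1)[of _ x k] level_Suc_no_zoom(1)[of x k]
    by (cases "\<exists>s\<in>signs. zoom s x \<in> cube") (metis, force)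
qed

text \<open>The cube of \<open>s\<close> lies in the plateau of its own bump. For any other sign
  vector some coordinate is at distance more than 1 - l > 1/2 from that centre, so the other bumps
  vanish there.\<close>

lemma level_0_zoom:
  fixes x :: "'a::euclidean_space"
  assumes s: "s \<in> signs" "zoom s x \<in> cube"
  shows "level 0 x = s" "dlevel 0 x v = 0"
proof -
  have 1: "bump (x - (1/2) *\<^sub>R s) = 1" "dbump (x - (1/2) *\<^sub>R s) v = 0"
    using zoom_in_cubeD[OF s(2)] by (auto intro!: bump_inside simp: inner_diff_left less_imp_le)
  have 0: "bump (x - (1/2) *\<^sub>R t) = 0 \<and> dbump (x - (1/2) *\<^sub>R t) v = 0" if t: "t \<in> signs - {s}" for t
  proof -
    obtain i where i: "i \<in> Basis" "t \<bullet> i \<noteq> s \<bullet> i" using t by (auto simp: euclidean_eq_iff[of t])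
    have "s \<bullet> i = 1 \<or> s \<bullet> i = -1" "t \<bullet> i = 1 \<or> t \<bullet> i = -1"
      using s t i by (auto simp: signs_def)
    then have "1/2 \<le> \<bar>(x - (1/2) *\<^sub>R t) \<bullet> i\<bar>"
      using zoom_in_cubeD[OF s(2) i(1)] i l by (auto simp: inner_diff_left)
    then show ?thesis using bump_outside[OF i(1)] by auto
  qed
  have "level 0 x = bump (x - (1/2) *\<^sub>R s) *\<^sub>R s + (\<Sum>t\<in>signs - {s}. bump (x - (1/2) *\<^sub>R t) *\<^sub>R t)"
    using s by (simp add: sum.remove[OF finite_signs])
  also have "(\<Sum>t\<in>signs - {s}. bump (x - (1/2) *\<^sub>R t) *\<^sub>R t) = 0" by (rule sum.neutral) (simp add: 0)
  finally show "level 0 x = s" by (simp add: 1)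
  have "dbump (x - (1/2) *\<^sub>R t) v = 0" if "t \<in> signs" for t using 0[of t] 1 that by (cases "t = s") auto
  then show "dlevel 0 x v = 0" by simp
qed

text \<open>Level 0 is locally constant on the first-generation cubes, and all higher levels live
  only there. For j > 0 both gradients are rescaled copies inside the same cube, and zooming lowers
  both indices by one.\<close>

lemma dlevel_disjoint: "j < k \<Longrightarrow> dlevel j x v = 0 \<or> dlevel k x w = 0"
proof (induction j arbitrary: k x)
  case 0
  then obtain k' where k': "k = Suc k'" by (cases k) auto
  show ?case
  proof (cases "\<exists>s\<in>signs. zoom s x \<in> cube")
    case True then show ?thesis using level_0_zoom(2) by blast
  next
    case False then show ?thesis using level_Suc_no_zoom(2)[of x k'] k' by blast
  qed
next
  case (Suc j)
  then obtain k' where k': "k = Suc k'" "j < k'" by (cases k) auto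
  show ?case
  proof (cases "\<exists>s\<in>signs. zoom s x \<in> cube")
    case True
    then obtain s where s: "s \<in> signs" "zoom s x \<in> cube" by blast
    show ?thesis using Suc.IH[OF k'(2), of "zoom s x"] unfolding k' level_Suc_zoom(2)[OF s] by auto
  next
    case False then show ?thesis using level_Suc_no_zoom(2)[of x j] by blast
  qed
qed

section \<open>Reading the digits on the Cantor set\<close>

lemma digit_weights_power: "digit_weights (\<lambda>k. l ^ k / 2) l"
  using l by unfold_locales auto

text \<open>The weights add up to (1/2)/(1-l), strictly below 1. Hence every coded point lies in the
  open cube, as the zoom lemmas require.\<close>

lemma digit_sum_in_cube:
  fixes \<omega> :: "nat \<Rightarrow> 'a::euclidean_space"
  assumes \<omega>: "\<And>j. \<omega> j \<in> signs"
  shows "digit_sum (\<lambda>k. l ^ k / 2) \<omega> \<in> cube"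
proof -
  interpret digit_weights "\<lambda>k. l ^ k / 2" l by (rule digit_weights_power)
  have "\<bar>digit_sum (\<lambda>k. l ^ k / 2) \<omega> \<bullet> i\<bar> < 1" if i: "i \<in> Basis" for i
  proof -
    have "\<bar>digit_sum (\<lambda>k. l ^ k / 2) \<omega> \<bullet> i\<bar> = norm (\<Sum>k. (l ^ k / 2) *\<^sub>R \<omega> k \<bullet> i)"
      unfolding digit_sum_def
      using bounded_linear.suminf[OF bounded_linear_inner_left[of i] summable_digits[of \<omega>]] \<omega> by simp
    also have "\<dots> \<le> (\<Sum>k. l ^ k / 2)"
    proof (rule norm_suminf_le)
      show "norm ((l ^ k / 2) *\<^sub>R \<omega> k \<bullet> i) \<le> l ^ k / 2" for k
        using abs_signs[OF \<omega>[of k] i] l by (simp add: abs_mult)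
      show "summable (\<lambda>k. l ^ k / 2)" using summable_weights[of 0] by simp
    qed
    also have "\<dots> \<le> (1/2) / (1 - l)" using tail_le[of 0] by simp
    also have "\<dots> < 1" using l by simp
    finally show ?thesis .
  qed
  then show ?thesis by (simp add: cube_def)
qed

lemma zoom_digit_sum:
  fixes \<omega> :: "nat \<Rightarrow> 'a::euclidean_space"
  assumes \<omega>: "\<And>j. \<omega> j \<in> signs"
  shows "zoom (\<omega> 0) (digit_sum (\<lambda>k. l ^ k / 2) \<omega>) = digit_sum (\<lambda>k. l ^ k / 2) (\<lambda>j. \<omega> (Suc j))"
proof -
  interpret digit_weights "\<lambda>k. l ^ k / 2" l by (rule digit_weights_power)
  have "digit_sum (\<lambda>k. l ^ k / 2) \<omega> = (1/2) *\<^sub>R \<omega> 0 + (\<Sum>k. (l ^ Suc k / 2) *\<^sub>R \<omega> (Suc k))"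
    using suminf_split_head[OF summable_digits[of \<omega>]] \<omega> by (simp add: digit_sum_def)
  also have "(\<Sum>k. (l ^ Suc k / 2) *\<^sub>R \<omega> (Suc k)) = (\<Sum>k. l *\<^sub>R ((l ^ k / 2) *\<^sub>R \<omega> (Suc k)))"
    by simp
  also have "\<dots> = l *\<^sub>R digit_sum (\<lambda>k. l ^ k / 2) (\<lambda>j. \<omega> (Suc j))"
    unfolding digit_sum_def using \<omega> by (intro suminf_scaleR_right[symmetric] summable_digits)
  finally show ?thesis using l by (simp add: zoom_def)
qed

text \<open>Zooming into the cube of the first digit acts on codes as the shift, so
  \<open>level k\<close> reads the first digit after k shifts.\<close>

lemma level_digit_sum:
  fixes \<omega> :: "nat \<Rightarrow> 'a::euclidean_space"
  assumes \<omega>: "\<And>j. \<omega> j \<in> signs"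
  shows "level k (digit_sum (\<lambda>k. l ^ k / 2) \<omega>) = \<omega> k"
  using assms
proof (induction k arbitrary: \<omega>)
  case 0
  show ?case
    using 0 digit_sum_in_cube[of "\<lambda>j. \<omega> (Suc j)"] by (intro level_0_zoom(1)) (auto simp: zoom_digit_sum)
next
  case (Suc k)
  have "level (Suc k) (digit_sum (\<lambda>k. l ^ k / 2) \<omega>) = level k (zoom (\<omega> 0) (digit_sum (\<lambda>k. l ^ k / 2) \<omega>))"
    using Suc.prems digit_sum_in_cube[of "\<lambda>j. \<omega> (Suc j)"] by (intro level_Suc_zoom(1)) (auto simp: zoom_digit_sum)
  then show ?case using Suc.IH[of "\<lambda>j. \<omega> (Suc j)"] Suc.prems by (simp add: zoom_digit_sum)
qed

end

subsection \<open>Energy estimate\<close>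

text \<open>The p-th power of the Hilbert-Schmidt norm of a gradient at one point: the integrand in
  \<open>V1p\<close> when \<open>A\<close> is \<open>G x\<close>.\<close>

definition gradient_energy :: "real \<Rightarrow> ('a::euclidean_space \<Rightarrow> 'b::euclidean_space) \<Rightarrow> real" where
  "gradient_energy p A = sqrt (\<Sum>i\<in>Basis. (norm (A i))\<^sup>2) powr p"

lemma gradient_energy_nonneg: "0 \<le> gradient_energy p A"
  by (simp add: gradient_energy_def)

lemma gradient_energy_zero: "(\<And>i. i \<in> Basis \<Longrightarrow> A i = 0) \<Longrightarrow> gradient_energy p A = 0"
  by (simp add: gradient_energy_def)

lemma gradient_energy_scaleR:
  assumes "0 \<le> c" shows "gradient_energy p (\<lambda>i. c *\<^sub>R A i) = c powr p * gradient_energy p A"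
proof -
  have "sqrt (\<Sum>i\<in>Basis. (norm (c *\<^sub>R A i))\<^sup>2) = c * sqrt (\<Sum>i\<in>Basis. (norm (A i))\<^sup>2)"
    using assms by (simp add: power_mult_distrib sum_distrib_left[symmetric] real_sqrt_mult)
  then show ?thesis using assms by (simp add: gradient_energy_def powr_mult sum_nonneg)
qed

text \<open>Replaces Hoelder's inequality in passing from a p-integrable gradient to a locally
  integrable one: on a compact set the constant 1 is integrable.\<close>

lemma norm_le_gradient_energy:
  assumes "i \<in> Basis" "1 \<le> p" shows "norm (A i) \<le> 1 + gradient_energy p A"
proof -
  define g where "g = sqrt (\<Sum>i\<in>Basis. (norm (A i))\<^sup>2)"
  have "(norm (A i))\<^sup>2 \<le> (\<Sum>i\<in>Basis. (norm (A i))\<^sup>2)"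
    using assms by (intro member_le_sum) auto
  then have "norm (A i) \<le> g" unfolding g_def by (rule real_le_rsqrt)
  also have "g \<le> 1 + g powr p"
  proof (cases "g \<le> 1")
    case False
    then have "g powr 1 \<le> g powr p" using assms by (intro powr_mono) auto
    then show ?thesis using False by simp
  qed (simp add: add_increasing2)
  finally show ?thesis by (simp add: gradient_energy_def g_def)
qed

context cantor_ratio
begin

lemma borel_measurable_energy [measurable]:
  "(\<lambda>x. gradient_energy p (dlevel k x)) \<in> borel_measurable borel"
proof -
  have [measurable]: "(\<lambda>x. dlevel k x v) \<in> borel_measurable borel" for v :: 'a
    by (rule borel_measurable_continuous_onI[OF continuous_dlevel])
  show ?thesis unfolding gradient_energy_def by measurable
qed

lemma nn_integral_zoom:
  fixes F :: "'a::euclidean_space \<Rightarrow> ennreal"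
  assumes [measurable]: "F \<in> borel_measurable borel"
  shows "(\<integral>\<^sup>+ x. F (zoom s x) \<partial>lborel) = ennreal (l ^ DIM('a)) * (\<integral>\<^sup>+ x. F x \<partial>lborel)"
proof -
  have [measurable]: "zoom s \<in> borel \<rightarrow>\<^sub>M borel"
    unfolding zoom_def by measurable
  have inv: "zoom s ((1/2) *\<^sub>R s + l *\<^sub>R x) = x" for x using l by (simp add: zoom_def)
  have "(\<integral>\<^sup>+ x. F (zoom s x) \<partial>lborel) =
      (\<integral>\<^sup>+ x. F (zoom s x) \<partial>density (distr lborel borel (\<lambda>x. (1/2) *\<^sub>R s + l *\<^sub>R x)) (\<lambda>_. \<bar>l\<bar> ^ DIM('a)))"
    using lborel_affine[of l "(1/2) *\<^sub>R s"] l by simp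
  also have "\<dots> = (\<integral>\<^sup>+ x. ennreal (l ^ DIM('a)) * F x \<partial>lborel)"
    using l by (simp add: nn_integral_density nn_integral_distr inv)
  also have "\<dots> = ennreal (l ^ DIM('a)) * (\<integral>\<^sup>+ x. F x \<partial>lborel)" by (intro nn_integral_cmult) simp
  finally show ?thesis .
qed

text \<open>There are 2^n copies; each magnifies the gradient by 1/l and contracts volume by
  l^n.\<close>

lemma energy_Suc_le:
  "(\<integral>\<^sup>+ x. ennreal (gradient_energy p (dlevel (Suc k) x)) \<partial>(lborel :: 'a::euclidean_space measure))
    \<le> ennreal (2 ^ DIM('a) * (1 / l) powr p * l ^ DIM('a)) *
      (\<integral>\<^sup>+ x. ennreal (gradient_energy p (dlevel k x)) \<partial>(lborel :: 'a measure))" (is "?L \<le> _ * ?I")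
proof -
  let ?F = "\<lambda>x::'a. ennreal (gradient_energy p (dlevel k x))"
  have "ennreal (gradient_energy p (dlevel (Suc k) x)) \<le> (\<Sum>s\<in>signs. ennreal ((1 / l) powr p) * ?F (zoom s x))" for x :: 'a
  proof (cases "\<exists>s\<in>signs. zoom s x \<in> cube")
    case True
    then obtain s where s: "s \<in> signs" "zoom s x \<in> cube" by blast
    have "ennreal (gradient_energy p (dlevel (Suc k) x)) = ennreal ((1 / l) powr p) * ?F (zoom s x)"
      using l unfolding level_Suc_zoom(2)[OF s] by (subst gradient_energy_scaleR) (auto simp: ennreal_mult')
    also have "\<dots> \<le> (\<Sum>s\<in>signs. ennreal ((1 / l) powr p) * ?F (zoom s x))"
      using s(1) finite_signs by (intro member_le_sum) auto
    finally show ?thesis .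
  next
    case False
    then show ?thesis using level_Suc_no_zoom(2)[of x k] by (subst gradient_energy_zero) auto
  qed
  then have "?L \<le> (\<integral>\<^sup>+ x. (\<Sum>s\<in>signs. ennreal ((1 / l) powr p) * ?F (zoom s x)) \<partial>lborel)"
    by (intro nn_integral_mono) auto
  also have "\<dots> = (\<Sum>s\<in>signs. \<integral>\<^sup>+ x. ennreal ((1 / l) powr p) * ?F (zoom s x) \<partial>lborel)"
    by (intro nn_integral_sum) (simp add: zoom_def)
  also have "\<dots> = (\<Sum>s\<in>(signs :: 'a set). ennreal ((1 / l) powr p) * (ennreal (l ^ DIM('a)) * ?I))"
  proof (intro sum.cong refl)
    fix s :: 'a
    have "(\<lambda>x. ?F (zoom s x)) \<in> borel_measurable lborel" by (simp add: zoom_def)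
    then show "(\<integral>\<^sup>+ x. ennreal ((1 / l) powr p) * ?F (zoom s x) \<partial>lborel) = ennreal ((1 / l) powr p) * (ennreal (l ^ DIM('a)) * ?I)"
      by (simp add: nn_integral_cmult nn_integral_zoom[where F = ?F])
  qed
  also have "\<dots> = ennreal (2 ^ DIM('a) * (1 / l) powr p * l ^ DIM('a)) * ?I"
    using l by (simp add: card_signs ennreal_mult ennreal_power[symmetric] mult.assoc)
  finally show ?thesis .
qed

lemma energy_0_finite:
  assumes "0 < p"
  shows "(\<integral>\<^sup>+ x. ennreal (gradient_energy p (dlevel 0 x)) \<partial>(lborel :: 'a::euclidean_space measure)) < \<infinity>"
proof -
  have norm_le: "norm x \<le> real DIM('a)" if "x \<in> cube" for x :: 'a
    using norm_le_l1[of x] sum_bounded_above[of Basis "\<lambda>i. \<bar>x \<bullet> i\<bar>" 1] that by (force simp: cube_def)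
  have "integrable lborel (\<lambda>x::'a. gradient_energy p (dlevel 0 x))"
  proof (rule integrable_compact_support[where r = "real DIM('a)"])
    show "continuous_on UNIV (\<lambda>x::'a. gradient_energy p (dlevel 0 x))"
      unfolding gradient_energy_def using assms
      by (intro continuous_on_powr' continuous_intros continuous_dlevel) (auto simp: sum_nonneg)
    show "gradient_energy p (dlevel 0 x) = 0" if "x \<notin> cball 0 (real DIM('a))" for x :: 'a
      using norm_le[of x] that dlevel_outside[of x 0] by (intro gradient_energy_zero) auto
  qed
  then show ?thesis by (simp add: nn_integral_eq_integral gradient_energy_nonneg)
qed

lemma energy_le:
  "(\<integral>\<^sup>+ x. ennreal (gradient_energy p (dlevel k x)) \<partial>(lborel :: 'a::euclidean_space measure))
    \<le> ennreal ((2 ^ DIM('a) * (1 / l) powr p * l ^ DIM('a)) ^ k) *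
      (\<integral>\<^sup>+ x. ennreal (gradient_energy p (dlevel 0 x)) \<partial>(lborel :: 'a measure))"
proof (induction k)
  case (Suc k)
  define q where "q = 2 ^ DIM('a) * (1 / l) powr p * l ^ DIM('a)"
  have q: "0 \<le> q" using l by (simp add: q_def)
  note energy_Suc_le[where 'a = 'a, of p k, folded q_def]
  also note mult_left_mono[OF Suc[folded q_def], of "ennreal q"]
  finally show ?case unfolding q_def[symmetric] using q
    by (simp add: ennreal_mult mult.assoc del: dlevel.simps)
qed simp

lemma at_most_one_gradient:
  obtains k where "\<And>j v. j \<noteq> k \<Longrightarrow> dlevel j x v = 0"
proof (cases "\<exists>k v. dlevel k x v \<noteq> 0")
  case True
  then obtain k v where k: "dlevel k x v \<noteq> 0" by blast
  have "dlevel j x w = 0" if "j \<noteq> k" for j w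
    using dlevel_disjoint[of j k x w v] dlevel_disjoint[of k j x v w] that k by (cases "j < k") auto
  then show ?thesis by (rule that)
qed (use that in auto)

text \<open>The levels are uniformly bounded, so summable weights give uniform convergence, hence
  continuity and a bound for the partial sums. The gradients converge only pointwise, but with at
  most one nonzero term at each point, so the energy of the sum is controlled termwise.\<close>

lemma level_series_in_V1p:
  fixes R :: "nat \<Rightarrow> real"
  assumes p: "1 \<le> p" and R: "\<And>k. 0 \<le> R k" "summable R"
    and en: "summable (\<lambda>k. R k powr p * (2 ^ DIM('a) * (1 / l) powr p * l ^ DIM('a)) ^ k)"
  shows "continuous_on UNIV (\<lambda>x::'a::euclidean_space. \<Sum>k. R k *\<^sub>R level k x)"
    and "(\<lambda>x::'a. \<Sum>k. R k *\<^sub>R level k x) \<in> V1p p"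
proof -
  define u where "u = (\<lambda>x::'a. \<Sum>k. R k *\<^sub>R level k x)"
  define U where "U m x = (\<Sum>k<m. R k *\<^sub>R level k x)" for m and x :: 'a
  define DU where "DU m x v = (\<Sum>k<m. R k *\<^sub>R dlevel k x v)" for m and x v :: 'a
  define G where "G x v = (\<Sum>k. R k *\<^sub>R dlevel k x v)" for x v :: 'a
  define B where "B = 2 ^ DIM('a) * real DIM('a)"
  have term_le: "norm (R k *\<^sub>R level k x) \<le> R k * B" for k and x :: 'a
    using norm_level_le[of k x] R(1)[of k] by (simp add: B_def mult_left_mono)
  have sB: "summable (\<lambda>k. R k * B)" by (intro summable_mult2 R)
  have ul: "uniform_limit UNIV U u sequentially"
    unfolding U_def[abs_def] u_def using term_le sB by (intro Weierstrass_m_test) auto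
  have Ucont: "continuous_on UNIV (U m)" for m
    unfolding U_def[abs_def] by (intro continuous_intros continuous_level)
  have ucont: "continuous_on UNIV u"
    by (rule uniform_limit_theorem[OF _ ul]) (use Ucont in auto)
  then show "continuous_on UNIV (\<lambda>x::'a. \<Sum>k. R k *\<^sub>R level k x)" by (simp add: u_def)
  have umeas: "u \<in> borel_measurable lborel" using borel_measurable_continuous_onI[OF ucont] by simp
  have uloc: "locally_integrable u"
    unfolding locally_integrable_def set_integrable_def
    using umeas by (auto intro!: borel_integrable_compact continuous_on_subset[OF ucont])
  \<comment> \<open>The index depends on the point. Partial sums of the gradient are 0 up to it and
    equal \<open>G\<close> afterwards, which yields both their convergence and their domination by
    \<open>G\<close>.\<close>
  have single: "\<exists>k. \<forall>v. G x v = R k *\<^sub>R dlevel k x v \<and> (\<forall>m. DU m x v = (if k < m then G x v else 0))" for x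
  proof -
    obtain k where k: "\<And>j v. j \<noteq> k \<Longrightarrow> dlevel j x v = 0" using at_most_one_gradient[of x] by blast
    have G: "G x v = R k *\<^sub>R dlevel k x v" for v
      unfolding G_def by (subst suminf_finite[of "{k}"]) (auto simp: k)
    have "DU m x v = (if k < m then G x v else 0)" for m v
    proof -
      have "DU m x v = (\<Sum>j<m. if j = k then R k *\<^sub>R dlevel k x v else 0)"
        unfolding DU_def by (intro sum.cong) (auto simp: k)
      then show ?thesis by (simp add: G)
    qed
    with G show ?thesis by blast
  qed
  have DUlim: "(\<lambda>m. DU m x v) \<longlonglongrightarrow> G x v" for x v
  proof -
    obtain k where k: "\<And>m. DU m x v = (if k < m then G x v else 0)" using single[of x] by blast
    then show ?thesis by (intro tendsto_eventually eventually_sequentiallyI[of "Suc k"]) auto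
  qed
  have DUle: "norm (DU m x v) \<le> norm (G x v)" for m x v
  proof -
    obtain k where "\<And>m. DU m x v = (if k < m then G x v else 0)" using single[of x] by blast
    then show ?thesis by simp
  qed
  have DUcont: "continuous_on UNIV (\<lambda>x. DU m x v)" for m v
    unfolding DU_def by (intro continuous_intros continuous_dlevel)
  have Gmeas [measurable]: "(\<lambda>x. G x v) \<in> borel_measurable borel" for v
    by (rule borel_measurable_LIMSEQ_metric[OF borel_measurable_continuous_onI[OF DUcont] DUlim])
  define I where "I = (\<integral>\<^sup>+ x. ennreal (gradient_energy p (dlevel 0 x)) \<partial>(lborel :: 'a measure))"
  have I: "I < \<infinity>" unfolding I_def using p by (intro energy_0_finite) auto
  define q where "q = 2 ^ DIM('a) * (1 / l) powr p * l ^ DIM('a)"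
  have q: "0 \<le> q" using l by (simp add: q_def)
  have Gmeas' [measurable]: "(\<lambda>x. gradient_energy p (G x)) \<in> borel_measurable borel"
    unfolding gradient_energy_def by measurable
  have "(\<integral>\<^sup>+ x. ennreal (gradient_energy p (G x)) \<partial>lborel)
      \<le> (\<integral>\<^sup>+ x. (\<Sum>k. ennreal (R k powr p) * ennreal (gradient_energy p (dlevel k x))) \<partial>(lborel :: 'a measure))"
  proof (rule nn_integral_mono)
    fix x :: 'a
    obtain k where "\<And>v. G x v = R k *\<^sub>R dlevel k x v" using single[of x] by blast
    then have "G x = (\<lambda>v. R k *\<^sub>R dlevel k x v)" by auto
    then have "ennreal (gradient_energy p (G x)) = ennreal (R k powr p) * ennreal (gradient_energy p (dlevel k x))"
      using R by (simp add: gradient_energy_scaleR ennreal_mult')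
    also have "\<dots> = (\<Sum>k\<in>{k}. ennreal (R k powr p) * ennreal (gradient_energy p (dlevel k x)))" by simp
    also have "\<dots> \<le> (\<Sum>k. ennreal (R k powr p) * ennreal (gradient_energy p (dlevel k x)))"
      by (rule sum_le_suminf) auto
    finally show "ennreal (gradient_energy p (G x)) \<le> \<dots>" .
  qed
  also have "\<dots> = (\<Sum>k. \<integral>\<^sup>+ x. ennreal (R k powr p) * ennreal (gradient_energy p (dlevel k x)) \<partial>(lborel :: 'a measure))"
    by (rule nn_integral_suminf) measurable
  also have "\<dots> = (\<Sum>k. ennreal (R k powr p) * (\<integral>\<^sup>+ x. ennreal (gradient_energy p (dlevel k x)) \<partial>(lborel :: 'a measure)))"
    by (simp add: nn_integral_cmult)
  also have "\<dots> \<le> (\<Sum>k. ennreal (R k powr p) * (ennreal (q ^ k) * I))"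
    unfolding q_def I_def by (intro suminf_le mult_left_mono energy_le) auto
  also have "\<dots> = (\<Sum>k. ennreal (R k powr p * q ^ k) * I)"
    using q by (simp add: ennreal_mult mult.assoc)
  also have "\<dots> = (\<Sum>k. ennreal (R k powr p * q ^ k)) * I" by simp
  also have "(\<Sum>k. ennreal (R k powr p * q ^ k)) = ennreal (\<Sum>k. R k powr p * q ^ k)"
    using q en by (intro suminf_ennreal2) (auto simp: q_def)
  also have "\<dots> * I < \<infinity>" using I by (simp add: ennreal_mult_less_top)
  finally have Gint: "integrable lborel (\<lambda>x. gradient_energy p (G x))"
    by (intro integrableI_nonneg) (auto simp: gradient_energy_nonneg)
  have Gloc: "locally_integrable (\<lambda>x. G x i)" if i: "i \<in> Basis" for i
    unfolding locally_integrable_def set_integrable_def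
  proof (intro conjI allI impI)
    fix K :: "'a set" assume K: "compact K"
    have [measurable]: "K \<in> sets borel" using K by (simp add: borel_compact)
    show "integrable lborel (\<lambda>x. indicator K x *\<^sub>R G x i)"
    proof (rule Bochner_Integration.integrable_bound)
      show "integrable lborel (\<lambda>x. indicator K x + gradient_energy p (G x))"
        using K Gint emeasure_compact_finite[OF K]
        by (intro Bochner_Integration.integrable_add integrable_real_indicator) auto
      show "AE x in lborel. norm (indicator K x *\<^sub>R G x i) \<le> norm (indicator K x + gradient_energy p (G x))"
      proof (rule AE_I2)
        fix x show "norm (indicator K x *\<^sub>R G x i) \<le> norm (indicator K x + gradient_energy p (G x))"
          using norm_le_gradient_energy[OF i p, of "G x"] gradient_energy_nonneg[of p "G x"]
          by (auto simp: indicator_def)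
      qed
    qed measurable
  qed simp
  have "weak_gradient u G"
  proof (rule weak_gradient_limit[where U = U and DU = DU and K = "\<Sum>k. R k * B"])
    show "(U m has_derivative DU m x) (at x)" for m x
      unfolding U_def[abs_def] DU_def[abs_def]
      by (intro has_derivative_sum has_derivative_scaleR_right level_deriv)
    show "(\<lambda>m. U m x) \<longlonglongrightarrow> u x" for x using tendsto_uniform_limitI[OF ul] by simp
    show "norm (U m x) \<le> (\<Sum>k. R k * B)" for m x
    proof -
      have "norm (U m x) \<le> (\<Sum>k<m. R k * B)" unfolding U_def using term_le by (intro sum_norm_le)
      also have "\<dots> \<le> (\<Sum>k. R k * B)" using sB R by (intro sum_le_suminf) (auto simp: B_def)
      finally show ?thesis .
    qed
  qed (use DUcont DUlim DUle Gloc umeas in auto)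
  with uloc Gint show "(\<lambda>x::'a. \<Sum>k. R k *\<^sub>R level k x) \<in> V1p p"
    unfolding V1p_def gradient_energy_def u_def[symmetric] by blast
qed

end

section \<open>Growth of the gauge along the image weights\<close>

lemma log_power_dominates:
  fixes \<sigma> \<gamma> c \<tau> K :: real
  assumes \<tau>: "0 < \<tau>" "\<tau> < 1" and c: "0 < c" and \<gamma>: "\<sigma> < \<gamma>" "0 \<le> \<gamma>"
  shows "\<forall>\<^sub>F k in sequentially. K \<le> real (Suc k) powr (- \<sigma>) * ln (1 / (c * (\<tau> ^ k / real (Suc k)))) powr \<gamma>"
proof -
  \<comment> \<open>Half the linear growth rate of the logarithm: the other half absorbs
    \<open>ln c\<close> and the shift from k to k + 1 once k is large.\<close>
  define a where "a = ln (1 / \<tau>) / 2"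
  have a: "a > 0" using \<tau> by (simp add: a_def ln_div)
  have "filterlim (\<lambda>k. exp ((\<gamma> - \<sigma>) * ln (real (Suc k)))) at_top sequentially"
    using \<gamma> by (intro filterlim_compose[OF exp_at_top] filterlim_tendsto_pos_mult_at_top[OF tendsto_const]
        filterlim_compose[OF ln_at_top] filterlim_compose[OF filterlim_real_sequentially] filterlim_Suc) auto
  then have "filterlim (\<lambda>k. real (Suc k) powr (\<gamma> - \<sigma>)) at_top sequentially"
    by (simp add: powr_def del: of_nat_Suc)
  then have ev1: "\<forall>\<^sub>F k in sequentially. K / a powr \<gamma> \<le> real (Suc k) powr (\<gamma> - \<sigma>)"
    by (simp add: filterlim_at_top)
  have ev2: "\<forall>\<^sub>F k in sequentially. (a + ln c) / a \<le> real k"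
    using filterlim_real_sequentially by (simp add: filterlim_at_top)
  show ?thesis
    using ev1 ev2
  proof eventually_elim
    case (elim k)
    have "a * real (Suc k) \<le> 2 * a * real k - ln c" using elim(2) a by (simp add: field_simps)
    also have "\<dots> \<le> 2 * a * real k - ln c + ln (real (Suc k))" by simp
    also have "\<dots> = ln (1 / (c * (\<tau> ^ k / real (Suc k))))"
      using \<tau> c by (simp add: a_def ln_div ln_mult ln_realpow)
    finally have "(a * real (Suc k)) powr \<gamma> \<le> ln (1 / (c * (\<tau> ^ k / real (Suc k)))) powr \<gamma>"
      using a \<gamma> by (intro powr_mono2) auto
    then have "real (Suc k) powr (- \<sigma>) * (a * real (Suc k)) powr \<gamma>
        \<le> real (Suc k) powr (- \<sigma>) * ln (1 / (c * (\<tau> ^ k / real (Suc k)))) powr \<gamma>"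
      by (intro mult_left_mono) auto
    moreover have "real (Suc k) powr (- \<sigma>) * (a * real (Suc k)) powr \<gamma> = a powr \<gamma> * real (Suc k) powr (\<gamma> - \<sigma>)"
      using a by (simp add: powr_mult powr_diff powr_minus divide_inverse)
    moreover have "K \<le> a powr \<gamma> * real (Suc k) powr (\<gamma> - \<sigma>)"
      using elim(1) a by (simp add: divide_le_eq mult.commute)
    ultimately show ?case by linarith
  qed
qed

theorem theorem6p1:
  fixes p \<alpha> \<sigma> \<gamma> :: real and \<phi> :: "real \<Rightarrow> real"
  assumes "p > real DIM('a::euclidean_space)"
    and "0 < \<alpha>" and "\<alpha> < real DIM('a)"
    and "\<sigma> = p * \<alpha> / (p + \<alpha> - real DIM('a))"
    and "\<gamma> > 1 + \<sigma>"
    and "gauge_function \<phi>"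
    and "\<exists>c>0. \<exists>r0>0. \<forall>r. 0 < r \<and> r < r0 \<longrightarrow>
           (1 / c) * (r powr \<sigma> * (ln (1 / r)) powr \<gamma>) \<le> \<phi> r \<and>
           \<phi> r \<le> c * (r powr \<sigma> * (ln (1 / r)) powr \<gamma>)"
  shows "\<exists>(u :: 'a \<Rightarrow> 'a) E. u \<in> V1p p \<and> continuous_on UNIV u \<and> compact E \<and>
           0 < hausdorff_dim \<alpha> E \<and> hausdorff_dim \<alpha> E < \<infinity> \<and>
           hausdorff_gauge \<phi> (u ` E) = \<infinity>"
proof -
  define n where "n = real DIM('a)"
  have n: "n \<ge> 1" using DIM_positive[where 'a = 'a] unfolding n_def by linarith
  note p = assms(1)[folded n_def] and \<alpha> = assms(2) assms(3)[folded n_def] and \<sigma>_eq = assms(4)[folded n_def]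
  have den: "0 < p + \<alpha> - n" using p \<alpha> by simp
  have \<sigma>: "0 < \<sigma>" using p \<alpha> n den by (simp add: \<sigma>_eq)
  \<comment> \<open>The difference of the two sides factors as (p - n)(n - \<alpha>). This gives
    \<sigma> < n and hence \<tau> < 1/2, the separation threshold for the image.\<close>
  have "p * \<alpha> < n * (p + \<alpha> - n)"
  proof -
    have "0 < (p - n) * (n - \<alpha>)" using p \<alpha> by simp
    then show ?thesis by (simp add: algebra_simps)
  qed
  then have \<sigma>n: "\<sigma> < n" using den by (simp add: \<sigma>_eq divide_less_eq)
  define l where "l = 2 powr (- n / \<alpha>)"
  define \<tau> where "\<tau> = 2 powr (- n / \<sigma>)"
  have half: "2 powr (- n / a) < 1/2" if "0 < a" "a < n" for a :: real
  proof -
    have "2 powr (- n / a) < 2 powr (- 1 :: real)" using that by (intro powr_less_mono) (auto simp: field_simps)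
    then show ?thesis by (simp add: powr_minus)
  qed
  have l: "0 < l" "l < 1/2" using half[OF \<alpha>] by (auto simp: l_def)
  have \<tau>: "0 < \<tau>" "\<tau> < 1/2" using half[OF \<sigma> \<sigma>n] by (auto simp: \<tau>_def)
  have power_powr: "((2 powr (- n / a)) ^ k) powr a = 1 / 2 ^ (DIM('a) * k)" if "0 < a" for a :: real and k
  proof -
    have "((2 powr (- n / a)) ^ k) powr a = 2 powr (- (real (DIM('a) * k)))"
      using that by (simp add: powr_power powr_powr n_def mult.commute)
    also have "\<dots> = 1 / 2 ^ (DIM('a) * k)" by (simp only: powr_minus_divide powr_realpow zero_less_numeral)
    finally show ?thesis .
  qed
  note l\<alpha> = power_powr[OF \<alpha>(1), folded l_def] and \<tau>\<sigma> = power_powr[OF \<sigma>, folded \<tau>_def]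
  define R where "R k = \<tau> ^ k / real (Suc k)" for k
  interpret cantor_ratio l using l by unfold_locales
  define \<rho> where "\<rho> k = l ^ k / 2" for k
  interpret E: digit_weights \<rho> l unfolding \<rho>_def by (rule digit_weights_power)
  interpret F: digit_weights R \<tau>
  proof
    fix k
    show "0 < R k" using \<tau> by (simp add: R_def)
    have "\<tau> ^ Suc k / real (Suc (Suc k)) \<le> \<tau> ^ Suc k / real (Suc k)"
      using \<tau> by (intro divide_left_mono) auto
    then show "R (Suc k) \<le> \<tau> * R k" by (simp add: R_def)
  qed (use \<tau> in auto)
  define \<Omega> where "\<Omega> = {\<omega> :: nat \<Rightarrow> 'a. \<forall>j. \<omega> j \<in> signs}"
  define E where "E = digit_sum \<rho> ` \<Omega>"
  define u where "u = (\<lambda>x::'a. \<Sum>k. R k *\<^sub>R level k x)"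
  have R0: "0 \<le> R k" for k using F.pos[of k] by simp
  have sR: "summable R" using F.summable_weights[of 0] by simp
  have en: "summable (\<lambda>k. R k powr p * (2 ^ DIM('a) * (1 / l) powr p * l ^ DIM('a)) ^ k)"
  proof -
    \<comment> \<open>This is where the formula for \<sigma> enters: it says p/\<sigma> = 1 + (p -
      n)/\<alpha>, which makes the exponent of 2 cancel. What is left of the energy series is the
      sum of (k+1)^{-p}.\<close>
    have one: "\<tau> powr p * (2 ^ DIM('a) * (1 / l) powr p * l ^ DIM('a)) = 1"
    proof -
      have "\<tau> powr p * (2 ^ DIM('a) * (1 / l) powr p * l ^ DIM('a)) =
          2 powr (- n * p / \<sigma>) * (2 powr n * 2 powr (n * p / \<alpha>) * 2 powr (- n * n / \<alpha>))"
        by (simp add: \<tau>_def l_def powr_powr n_def powr_realpow powr_minus_divide[symmetric] flip: powr_realpow)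
      also have "\<dots> = 2 powr (- n * p / \<sigma> + n + n * p / \<alpha> - n * n / \<alpha>)"
        by (simp add: powr_add[symmetric] algebra_simps)
      also have "- n * p / \<sigma> + n + n * p / \<alpha> - n * n / \<alpha> = 0"
        using den \<alpha> p n by (simp add: \<sigma>_eq field_simps)
      finally show ?thesis by simp
    qed
    have "R k powr p * (2 ^ DIM('a) * (1 / l) powr p * l ^ DIM('a)) ^ k = real (Suc k) powr (- p)" for k
    proof -
      define q where "q = 2 ^ DIM('a) * (1 / l) powr p * l ^ DIM('a)"
      have "(\<tau> ^ k) powr p = (\<tau> powr p) ^ k"
        using \<tau> by (simp only: powr_realpow[symmetric] powr_powr powr_gt_zero mult.commute)
      then have "R k powr p * q ^ k = (\<tau> powr p * q) ^ k * real (Suc k) powr (- p)"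
        unfolding R_def powr_minus_divide using \<tau> by (simp add: powr_divide power_mult_distrib del: of_nat_Suc)
      then show ?thesis using one unfolding q_def[symmetric] by simp
    qed
    moreover have "summable (\<lambda>k. real (Suc k) powr (- p))"
      using p n summable_real_powr_iff[of "- p"] by (subst summable_Suc_iff) simp
    ultimately show ?thesis by simp
  qed
  have "u \<in> V1p p" "continuous_on UNIV u"
    unfolding u_def using level_series_in_V1p[OF _ R0 sR en] p n by auto
  moreover have "compact E" unfolding E_def \<Omega>_def by (rule E.compact_digit_set)
  moreover have "hausdorff_dim \<alpha> E < \<infinity>"
    unfolding E_def \<Omega>_def
  proof (rule E.hausdorff_digit_set_finite[OF \<alpha>(1), where B = "(1/2) powr \<alpha>"])
    show "2 ^ (DIM('a) * k) * \<rho> k powr \<alpha> \<le> (1/2) powr \<alpha>" for k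
      using l l\<alpha>[of k] by (simp add: \<rho>_def powr_divide)
  qed
  moreover have "0 < hausdorff_dim \<alpha> E"
  proof -
    \<comment> \<open>The factor 2 in the separation constant cancels the 1/2 in
      \<open>\<rho>\<close>, so codes first differing at digit k are \<open>c * l ^ k\<close>
      apart.\<close>
    define c where "c = (1 - 2 * l) / (1 - l)"
    have c: "0 < c" using l by (simp add: c_def)
    have "ennreal (1 / (1 / c powr \<alpha>)) \<le> hausdorff_dim \<alpha> E"
      unfolding E_def \<Omega>_def
    proof (rule E.hausdorff_digit_set_ge[where ?k0.0 = 0])
      show "mono_on {0..} (\<lambda>r. r powr \<alpha>)" using \<alpha> by (auto intro!: mono_onI powr_mono2)
      show "1 / 2 ^ (DIM('a) * k) \<le> 1 / c powr \<alpha> * (2 * (1 - 2 * l) / (1 - l) * \<rho> k) powr \<alpha>" for k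
      proof -
        have "2 * (1 - 2 * l) / (1 - l) * \<rho> k = c * l ^ k"
          using l by (simp add: c_def \<rho>_def field_simps)
        then show ?thesis using c l l\<alpha>[of k] by (simp add: powr_mult)
      qed
    qed (use c in auto)
    moreover have "0 < ennreal (1 / (1 / c powr \<alpha>))" using c by simp
    ultimately show ?thesis by (rule less_le_trans[rotated])
  qed
  moreover have "hausdorff_gauge \<phi> (u ` E) = \<infinity>"
  proof -
    have "u (digit_sum \<rho> \<omega>) = digit_sum R \<omega>" if "\<omega> \<in> \<Omega>" for \<omega>
      using that unfolding u_def \<rho>_def digit_sum_def[of R] \<Omega>_def by (simp add: level_digit_sum)
    then have img: "u ` E = digit_sum R ` \<Omega>" unfolding E_def by (force simp: image_image)
    define c where "c = 2 * (1 - 2 * \<tau>) / (1 - \<tau>)"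
    have c: "0 < c" using \<tau> by (simp add: c_def)
    obtain c0 r0 where c0: "c0 > 0" "r0 > 0"
      and \<phi>: "\<And>r. 0 < r \<Longrightarrow> r < r0 \<Longrightarrow> (1 / c0) * (r powr \<sigma> * (ln (1 / r)) powr \<gamma>) \<le> \<phi> r"
      using assms(7) by blast
    \<comment> \<open>\<open>M\<close> is arbitrary, and letting it tend to 0 gives infinite
      measure. The mass bound holds only from some index on, depending on \<open>M\<close>, which is
      why the mass distribution principle admits a threshold \<open>k0\<close>.\<close>
    have big: "ennreal (1 / M) \<le> hausdorff_gauge \<phi> (u ` E)" if M: "0 < M" for M
    proof -
      have "(\<lambda>k. c * R k) \<longlonglongrightarrow> 0" by (rule tendsto_mult_right_zero[OF F.weights_tendsto_0])
      from order_tendstoD(2)[OF this c0(2)] have ev1: "\<forall>\<^sub>F k in sequentially. c * R k < r0" .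
      \<comment> \<open>The threshold is what remains to be beaten after
        \<open>(c * R k) powr \<sigma>\<close> is written as c^\<sigma> 2^{-nk} (k+1)^{-\<sigma>}
        and the mass 2^{-nk} is cancelled.\<close>
      have ev2: "\<forall>\<^sub>F k in sequentially. c0 / (M * c powr \<sigma>) \<le> real (Suc k) powr (- \<sigma>) * ln (1 / (c * R k)) powr \<gamma>"
        unfolding R_def using \<tau> c assms(5) \<sigma> by (intro log_power_dominates) auto
      have "\<forall>\<^sub>F k in sequentially. 1 / 2 ^ (DIM('a) * k) \<le> M * \<phi> (c * R k)"
        using ev1 ev2
      proof eventually_elim
        case (elim k)
        have "(c * R k) powr \<sigma> = c powr \<sigma> * (1 / 2 ^ (DIM('a) * k)) * real (Suc k) powr (- \<sigma>)"
          using \<tau> c \<tau>\<sigma>[of k] by (simp add: R_def powr_mult powr_divide powr_minus_divide)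
        moreover have "(1 / c0) * ((c * R k) powr \<sigma> * (ln (1 / (c * R k))) powr \<gamma>) \<le> \<phi> (c * R k)"
          using elim(1) c F.pos[of k] by (intro \<phi>) auto
        ultimately have "(1 / 2 ^ (DIM('a) * k)) * (M * c powr \<sigma> / c0 * (real (Suc k) powr (- \<sigma>) * ln (1 / (c * R k)) powr \<gamma>))
            \<le> M * \<phi> (c * R k)"
          using mult_left_mono[of _ _ M] M by (fastforce simp: ac_simps)
        moreover have "1 \<le> M * c powr \<sigma> / c0 * (real (Suc k) powr (- \<sigma>) * ln (1 / (c * R k)) powr \<gamma>)"
          using elim(2) M c c0 by (simp add: field_simps)
        then have "(1 / 2 ^ (DIM('a) * k)) * 1 \<le> (1 / 2 ^ (DIM('a) * k)) * (M * c powr \<sigma> / c0 * (real (Suc k) powr (- \<sigma>) * ln (1 / (c * R k)) powr \<gamma>))"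
          by (intro mult_left_mono) auto
        ultimately show ?case by linarith
      qed
      then obtain k0 where k0: "\<And>k. k \<ge> k0 \<Longrightarrow> 1 / 2 ^ (DIM('a) * k) \<le> M * \<phi> (c * R k)"
        by (auto simp: eventually_sequentially)
      show ?thesis
        unfolding img \<Omega>_def
        by (rule F.hausdorff_digit_set_ge[where ?k0.0 = k0])
          (use M k0 assms(6) in \<open>auto simp: c_def gauge_function_def\<close>)
    qed
    show ?thesis
    proof (rule ccontr)
      assume "hausdorff_gauge \<phi> (u ` E) \<noteq> \<infinity>"
      then obtain h where h: "0 \<le> h" "hausdorff_gauge \<phi> (u ` E) = ennreal h"
        by (cases "hausdorff_gauge \<phi> (u ` E)") auto
      \<comment> \<open>With this \<open>M\<close> the lower bound is h + 1, exceeding the supposed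
        finite value h.\<close>
      show False using big[of "1 / (h + 1)"] h by simp
    qed
  qed
  ultimately show ?thesis by blast
qed

end
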